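(* Let $G=(V,E)$ be a finite connected multi-graph and $\mathcal{H}$ a Schrödinger operator on $G$. Let $\mathcal{H}^{\mathrm{ab}}$ and $\mathcal{H}^{\mathrm{uni}}$ be the pull-backs of $\mathcal{H}$ to the maximal abelian cover $G^{\mathrm{ab}}$ and to the universal cover $\tilde G$ of $G$, acting on $\ell^2(V_{G^{\mathrm{ab}}})$ and $\ell^2(V_{\tilde G})$ respectively. If $\lambda$ is an eigenvalue of $\mathcal{H}^{\mathrm{ab}}$, then $|\lambda|\le\rho$, where $\rho$ is the spectral radius of $\mathcal{H}^{\mathrm{uni}}$.
   Context: Multi-graphs may have self-loops and multiple edges. $\vec{E}$ is the set of directed edges: every $e\in E$ (including each self-loop) appears in $\vec E$ with both orientations. For $e\in\vec E$, $o(e)$ and $t(e)$ are its origin and terminus and $e^{-1}$ is the same edge with the opposite orientation. A Schrödinger operator on a finite multi-graph $G$ is an operator $\mathcal{H}:\ell^2(V)\to\ell^2(V)$ with matrix entries $\mathcal{H}_{uv}=\sum_{e\in\vec E:\,o(e)=u,\,t(e)=v}w_e+\delta_{uv}\mathcal{V}_v$, where $w_e\in\mathbb{C}$, $w_e=\overline{w_{e^{-1}}}\neq 0$ and $\mathcal{V}_v\in\mathbb{R}$. The maximal abelian cover of $G$ is $G^{\mathrm{ab}}=\tilde G/[\pi_1(G),\pi_1(G)]$, where $\tilde G$ is the universal cover of $G$ and $\pi_1(G)$ acts on $\tilde G$ by deck transformations. The pull-back of $\mathcal{H}$ to a cover is the Schrödinger operator on the $\ell^2$ space of the vertices of the cover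 whose edge weights and vertex potentials are the pull-backs of those of $\mathcal{H}$ along the covering map. An eigenvalue of $\mathcal{H}^{\mathrm{ab}}$ is a $\lambda$ for which there is a nonzero $f\in\ell^2(V_{G^{\mathrm{ab}}})$ with $\mathcal{H}^{\mathrm{ab}}f=\lambda f$. *)

theory Defs
  imports
    "HOL-Analysis.Analysis"
    "HOL-Algebra.Generated_Groups"
    "HOL-Algebra.Group_Action"
    "Graph_Theory.Graph_Theory"
begin

section \<open>Multi-graphs\<close>

text \<open>
  A multi-graph is given by its set of directed edges: a \<^locale>\<open>bidirected_digraph\<close>, where \<open>arcs G\<close>
  is the set of directed edges, \<open>tail G e\<close> and \<open>head G e\<close> are origin and terminus of \<open>e\<close>, and
  \<open>arev\<close> reverses the orientation.  Since \<open>arev\<close> has no fixed points on \<open>arcs G\<close>, every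
  undirected edge, self-loops included, contributes exactly two arcs; parallel edges are allowed.
\<close>

section \<open>The universal cover\<close>

definition reduced_walk :: "('e \<Rightarrow> 'e) \<Rightarrow> 'e list \<Rightarrow> bool" where
  "reduced_walk arev p \<longleftrightarrow> successively (\<lambda>e f. f \<noteq> arev e) p"

fun reduce_walk_cons :: "('e \<Rightarrow> 'e) \<Rightarrow> 'e \<Rightarrow> 'e list \<Rightarrow> 'e list" where
  "reduce_walk_cons arev e [] = [e]"
| "reduce_walk_cons arev e (f # p) = (if f = arev e then p else e # f # p)"

text \<open>The reduced walk homotopic to a given walk, obtained by cancelling backtracks.\<close>

definition reduce_walk :: "('e \<Rightarrow> 'e) \<Rightarrow> 'e list \<Rightarrow> 'e list" where
  "reduce_walk arev p = foldr (reduce_walk_cons arev) p []"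

abbreviation endpoint :: "('v, 'e) pre_digraph \<Rightarrow> 'v \<Rightarrow> 'e list \<Rightarrow> 'v" where
  "endpoint G v0 p \<equiv> last (pre_digraph.awalk_verts G v0 p)"

text \<open>
  Vertices of the universal cover are the homotopy classes of walks starting at the base vertex
  \<open>v0\<close>, each represented by its unique reduced walk.  The pair \<open>(p, e)\<close> is the lift of the arc \<open>e\<close>
  starting at \<open>p\<close>; it ends at the class of \<open>p\<close> followed by \<open>e\<close>.
\<close>

definition universal_cover ::
    "('v, 'e) pre_digraph \<Rightarrow> ('e \<Rightarrow> 'e) \<Rightarrow> 'v \<Rightarrow> ('e list, 'e list \<times> 'e) pre_digraph" where
  "universal_cover G arev v0 =
    \<lparr> verts = {p. (\<exists>v. pre_digraph.awalk G v0 p v) \<and> reduced_walk arev p},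
      arcs = {(p, e). (\<exists>v. pre_digraph.awalk G v0 p v) \<and> reduced_walk arev p \<and>
                      e \<in> arcs G \<and> tail G e = endpoint G v0 p},
      tail = fst,
      head = (\<lambda>(p, e). reduce_walk arev (p @ [e])) \<rparr>"

text \<open>The covering map is \<open>endpoint G v0\<close> on vertices and \<open>snd\<close> on arcs.\<close>

section \<open>The maximal abelian cover\<close>

definition pi1 :: "('v, 'e) pre_digraph \<Rightarrow> ('e \<Rightarrow> 'e) \<Rightarrow> 'v \<Rightarrow> 'e list monoid" where
  "pi1 G arev v0 =
    \<lparr> carrier = {p. pre_digraph.awalk G v0 p v0 \<and> reduced_walk arev p},
      mult = (\<lambda>p q. reduce_walk arev (p @ q)),
      one = [] \<rparr>"

definition deck_vert :: "('e \<Rightarrow> 'e) \<Rightarrow> 'e list \<Rightarrow> 'e list \<Rightarrow> 'e list" where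
  "deck_vert arev g p = reduce_walk arev (g @ p)"

definition deck_arc :: "('e \<Rightarrow> 'e) \<Rightarrow> 'e list \<Rightarrow> 'e list \<times> 'e \<Rightarrow> 'e list \<times> 'e" where
  "deck_arc arev g = (\<lambda>(p, e). (deck_vert arev g p, e))"

definition commutator_pi1 :: "('v, 'e) pre_digraph \<Rightarrow> ('e \<Rightarrow> 'e) \<Rightarrow> 'v \<Rightarrow> 'e list monoid" where
  "commutator_pi1 G arev v0 =
    (pi1 G arev v0)\<lparr>carrier := derived (pi1 G arev v0) (carrier (pi1 G arev v0))\<rparr>"

text \<open>
  The quotient of the universal cover by the commutator subgroup: vertices and arcs are orbits.
  As \<open>tail\<close> and \<open>head\<close> are equivariant, the image of an orbit of arcs is an orbit of vertices.
\<close>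

definition abelian_cover ::
    "('v, 'e) pre_digraph \<Rightarrow> ('e \<Rightarrow> 'e) \<Rightarrow> 'v \<Rightarrow> ('e list set, ('e list \<times> 'e) set) pre_digraph" where
  "abelian_cover G arev v0 =
    \<lparr> verts = Group_Action.orbit (commutator_pi1 G arev v0) (deck_vert arev)
                ` verts (universal_cover G arev v0),
      arcs = Group_Action.orbit (commutator_pi1 G arev v0) (deck_arc arev)
                ` arcs (universal_cover G arev v0),
      tail = (\<lambda>A. tail (universal_cover G arev v0) ` A),
      head = (\<lambda>A. head (universal_cover G arev v0) ` A) \<rparr>"

text \<open>All members of an orbit lie over the same vertex or arc of \<open>G\<close>.\<close>

definition abelian_cover_vert :: "('v, 'e) pre_digraph \<Rightarrow> 'v \<Rightarrow> 'e list set \<Rightarrow> 'v" where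
  "abelian_cover_vert G v0 X = the_elem (endpoint G v0 ` X)"

definition abelian_cover_arc :: "('e list \<times> 'e) set \<Rightarrow> 'e" where
  "abelian_cover_arc A = the_elem (snd ` A)"

section \<open>Schroedinger operators\<close>

definition schroedinger_weights ::
    "('v, 'e) pre_digraph \<Rightarrow> ('e \<Rightarrow> 'e) \<Rightarrow> ('e \<Rightarrow> complex) \<Rightarrow> bool" where
  "schroedinger_weights G arev w \<longleftrightarrow> (\<forall>e\<in>arcs G. w e = cnj (w (arev e)) \<and> w e \<noteq> 0)"

definition schroedinger_entry ::
    "('v, 'e) pre_digraph \<Rightarrow> ('e \<Rightarrow> complex) \<Rightarrow> ('v \<Rightarrow> real) \<Rightarrow> 'v \<Rightarrow> 'v \<Rightarrow> complex" where
  "schroedinger_entry G w V u v =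
    (\<Sum>e | e \<in> arcs G \<and> tail G e = u \<and> head G e = v. w e) + (if u = v then of_real (V v) else 0)"

text \<open>On a locally finite graph, each row of the matrix has only finitely many nonzero entries.\<close>

definition schroedinger_op ::
    "('v, 'e) pre_digraph \<Rightarrow> ('e \<Rightarrow> complex) \<Rightarrow> ('v \<Rightarrow> real) \<Rightarrow> ('v \<Rightarrow> complex) \<Rightarrow> 'v \<Rightarrow> complex" where
  "schroedinger_op G w V f u = (\<Sum>\<^sub>\<infinity>v\<in>verts G. schroedinger_entry G w V u v * f v)"

definition universal_op ::
    "('v, 'e) pre_digraph \<Rightarrow> ('e \<Rightarrow> 'e) \<Rightarrow> 'v \<Rightarrow> ('e \<Rightarrow> complex) \<Rightarrow> ('v \<Rightarrow> real)
      \<Rightarrow> ('e list \<Rightarrow> complex) \<Rightarrow> 'e list \<Rightarrow> complex" where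
  "universal_op G arev v0 w V =
    schroedinger_op (universal_cover G arev v0) (w \<circ> snd) (V \<circ> endpoint G v0)"

definition abelian_op ::
    "('v, 'e) pre_digraph \<Rightarrow> ('e \<Rightarrow> 'e) \<Rightarrow> 'v \<Rightarrow> ('e \<Rightarrow> complex) \<Rightarrow> ('v \<Rightarrow> real)
      \<Rightarrow> ('e list set \<Rightarrow> complex) \<Rightarrow> 'e list set \<Rightarrow> complex" where
  "abelian_op G arev v0 w V =
    schroedinger_op (abelian_cover G arev v0) (w \<circ> abelian_cover_arc) (V \<circ> abelian_cover_vert G v0)"

section \<open>Operators on square-summable functions\<close>

text \<open>Functions on \<open>S\<close> are represented by functions on the whole type that vanish outside \<open>S\<close>.\<close>

definition ell2 :: "'a set \<Rightarrow> ('a \<Rightarrow> complex) set" where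
  "ell2 S = {f. (\<forall>x. x \<notin> S \<longrightarrow> f x = 0) \<and> (\<lambda>x. (cmod (f x))\<^sup>2) summable_on S}"

definition ell2_norm :: "'a set \<Rightarrow> ('a \<Rightarrow> complex) \<Rightarrow> real" where
  "ell2_norm S f = sqrt (\<Sum>\<^sub>\<infinity>x\<in>S. (cmod (f x))\<^sup>2)"

definition eigenvalue_ell2 :: "'a set \<Rightarrow> (('a \<Rightarrow> complex) \<Rightarrow> 'a \<Rightarrow> complex) \<Rightarrow> complex \<Rightarrow> bool" where
  "eigenvalue_ell2 S T z \<longleftrightarrow> (\<exists>f\<in>ell2 S. f \<noteq> (\<lambda>_. 0) \<and> T f = (\<lambda>x. z * f x))"

definition bounded_op_ell2 :: "'a set \<Rightarrow> (('a \<Rightarrow> complex) \<Rightarrow> 'a \<Rightarrow> complex) \<Rightarrow> bool" where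
  "bounded_op_ell2 S T \<longleftrightarrow>
    (\<forall>f\<in>ell2 S. T f \<in> ell2 S) \<and>
    (\<forall>f\<in>ell2 S. \<forall>g\<in>ell2 S. T (\<lambda>x. f x + g x) = (\<lambda>x. T f x + T g x)) \<and>
    (\<forall>c. \<forall>f\<in>ell2 S. T (\<lambda>x. c * f x) = (\<lambda>x. c * T f x)) \<and>
    (\<exists>C. \<forall>f\<in>ell2 S. ell2_norm S (T f) \<le> C * ell2_norm S f)"

definition spectrum_ell2 :: "'a set \<Rightarrow> (('a \<Rightarrow> complex) \<Rightarrow> 'a \<Rightarrow> complex) \<Rightarrow> complex set" where
  "spectrum_ell2 S T =
    {z. \<not> (\<exists>R. bounded_op_ell2 S R \<and>
              (\<forall>f\<in>ell2 S. R (\<lambda>x. T f x - z * f x) = f \<and> (\<lambda>x. T (R f) x - z * R f x) = f))}"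

text \<open>
  The supremum is taken in the extended reals, so that it is meaningful without first knowing that
  the spectrum is bounded.
\<close>

definition spectral_radius_ell2 :: "'a set \<Rightarrow> (('a \<Rightarrow> complex) \<Rightarrow> 'a \<Rightarrow> complex) \<Rightarrow> ereal" where
  "spectral_radius_ell2 S T = (SUP z\<in>spectrum_ell2 S T. ereal (cmod z))"

end

theory Submission
  imports Defs "HOL-Library.Function_Algebras" "Jordan_Normal_Form.Determinant"
begin

text \<open>
  Give every arc \<open>e\<close> of the finite graph an extra factor \<open>\<zeta>\<^sub>e\<close>, independently for distinct edges and
  with inverse factors on reversed arcs, and call the resulting matrix \<open>H\<^sub>\<zeta>\<close>.  Two facts about these
  matrices prove the theorem.

  First, an eigenvalue \<open>\<lambda>\<close> of the operator on the abelian cover is a zero of \<open>det (\<lambda> - H\<^sub>\<zeta>)\<close> for every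
  \<open>\<zeta>\<close>.  A vertex of the abelian cover is determined by its endpoint in the graph and by the homology
  class of the walks that lead to it (\<open>fibre_eq_iff\<close>), so an eigenfunction is a square summable
  solution of a translation invariant system on vertices times a lattice.  Suppose that
  \<open>det (\<lambda> - H\<^sub>\<zeta>)\<close> is nonzero for one \<open>\<zeta>\<close>, hence near it.  The generating functions of a finitely
  supported solution lie in the kernels of these matrices, so they vanish and so does the solution
  (\<open>signing_no_finite_solutions\<close>).  Consequently a solution on a large box is determined by its values
  near the boundary, and the solutions restricted to the box form a space whose dimension is
  negligible against the number of points.  The translates of one nonzero square summable solution,
  however, would force a dimension proportional to the number of points (\<open>evaluation_bound\<close>,
  \<open>no_ell2_lattice_solution\<close>).

  Second, if \<open>det (\<lambda> - H\<^sub>\<zeta>)\<close> vanishes for all choices of signs \<open>\<zeta>\<close>, then so does its mean over the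
  signs, which by an observation of Godsil and Gutman is the matching polynomial of the weighted
  graph.  Godsil's path tree turns a zero of a matching polynomial into an eigenvector of a finite
  section of the operator on the universal cover, since self-avoiding walks are reduced walks
  (\<open>path_tree_eigenfunction\<close>).  Therefore \<open>|\<lambda>|\<close> is at most the norm of that operator.  The operator is
  symmetric, so its norm or the negative of its norm lies in the spectrum (\<open>spectral_radius_ge\<close>).
\<close>

section \<open>Reduction of walks\<close>

context bidirected_digraph
begin

lemma reduced_walk_Nil [simp]: "reduced_walk arev []"
  by (simp add: reduced_walk_def)

lemma reduced_walk_Cons_Cons [simp]:
  "reduced_walk arev (e # f # p) \<longleftrightarrow> f \<noteq> arev e \<and> reduced_walk arev (f # p)"
  by (simp add: reduced_walk_def)

lemma reduced_walk_single [simp]: "reduced_walk arev [e]"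
  by (simp add: reduced_walk_def)

lemma reduced_walk_ConsD: "reduced_walk arev (e # p) \<Longrightarrow> reduced_walk arev p"
  by (cases p) auto

lemma reduced_walk_snoc:
  "reduced_walk arev (p @ [e]) \<longleftrightarrow> reduced_walk arev p \<and> (p = [] \<or> e \<noteq> arev (last p))"
  by (auto simp: reduced_walk_def successively_append_iff)

lemma reduced_reduce_walk_cons:
  "reduced_walk arev p \<Longrightarrow> reduced_walk arev (reduce_walk_cons arev e p)"
  by (cases p) (auto dest: reduced_walk_ConsD)

text \<open>
  Reducedness is essential: cancelling the first arc of \<open>p\<close> must not expose an arc that cancels again.
\<close>

lemma reduce_walk_cons_arev:
  assumes "reduced_walk arev p"
  shows "reduce_walk_cons arev e (reduce_walk_cons arev (arev e) p) = p"
proof (cases p)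
  case (Cons f q)
  then show ?thesis using assms by (cases q) auto
qed simp

text \<open>
  Prepending the arcs of a walk one at a time, with cancellation, is an action on reduced walks in
  which reversed arcs act as inverses.  All associativity and cancellation laws of reduction follow
  from this.
\<close>

definition act :: "'b list \<Rightarrow> 'b list \<Rightarrow> 'b list" where
  "act p x = foldr (reduce_walk_cons arev) p x"

lemma act_simps [simp]:
  "act [] x = x" "act (e # p) x = reduce_walk_cons arev e (act p x)"
  "act (p @ q) x = act p (act q x)"
  by (simp_all add: act_def)

lemma reduce_walk_act: "reduce_walk arev p = act p []"
  by (simp add: act_def reduce_walk_def)

lemma reduced_act: "reduced_walk arev x \<Longrightarrow> reduced_walk arev (act p x)"
  by (induction p) (auto intro: reduced_reduce_walk_cons)

lemma reduced_reduce_walk [simp]: "reduced_walk arev (reduce_walk arev p)"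
  by (simp add: reduce_walk_act reduced_act)

lemma act_reduce_walk_cons:
  assumes "reduced_walk arev x"
  shows "act (reduce_walk_cons arev e p) x = reduce_walk_cons arev e (act p x)"
  using reduce_walk_cons_arev[OF reduced_act[OF assms]] by (cases p) auto

text \<open>
  Homotopic walks act in the same way; this is what makes concatenation followed by reduction
  associative.
\<close>

lemma act_reduce_walk:
  "reduced_walk arev x \<Longrightarrow> act (reduce_walk arev p) x = act p x"
  unfolding reduce_walk_act by (induction p) (auto simp: act_reduce_walk_cons)

lemma reduce_walk_reduced: "reduced_walk arev p \<Longrightarrow> reduce_walk arev p = p"
  unfolding reduce_walk_act
proof (induction p)
  case (Cons e p)
  then show ?case by (cases p) (auto dest: reduced_walk_ConsD)
qed simp

lemma reduce_walk_Nil [simp]: "reduce_walk arev [] = []"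
  by (simp add: reduce_walk_act)

lemma reduce_walk_append_left [simp]:
  "reduce_walk arev (reduce_walk arev p @ q) = reduce_walk arev (p @ q)"
  by (simp add: reduce_walk_act[of "_ @ _"] act_reduce_walk reduced_act)

lemma reduce_walk_append_right [simp]:
  "reduce_walk arev (p @ reduce_walk arev q) = reduce_walk arev (p @ q)"
proof -
  have "act (reduce_walk arev q) [] = act q []"
    by (simp add: act_reduce_walk)
  then show ?thesis by (simp add: reduce_walk_act[of "_ @ _"])
qed

definition reverse_walk :: "'b list \<Rightarrow> 'b list" where
  "reverse_walk p = rev (map arev p)"

lemma reverse_walk_simps [simp]:
  "reverse_walk [] = []" "reverse_walk (e # p) = reverse_walk p @ [arev e]"
  "reverse_walk (p @ q) = reverse_walk q @ reverse_walk p"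
  "reverse_walk (reverse_walk p) = p"
  by (simp_all add: reverse_walk_def rev_map comp_def)

lemma act_reverse_walk:
  "reduced_walk arev x \<Longrightarrow> act (reverse_walk p) (act p x) = x"
proof (induction p arbitrary: x)
  case (Cons e p)
  have "reduce_walk_cons arev (arev e) (reduce_walk_cons arev e (act p x)) = act p x"
    using reduce_walk_cons_arev[OF reduced_act[OF Cons.prems], of "arev e"] by simp
  then show ?case using Cons by simp
qed simp

lemma reduce_walk_cancel [simp]:
  "reduce_walk arev (reverse_walk p @ p @ q) = reduce_walk arev q"
  "reduce_walk arev (p @ reverse_walk p @ q) = reduce_walk arev q"
  using act_reverse_walk[of "act q []" p] act_reverse_walk[of "act q []" "reverse_walk p"]
  by (simp_all add: reduce_walk_act reduced_act)

lemma reduce_walk_cancel_Nil [simp]: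
  "reduce_walk arev (reverse_walk p @ p) = []" "reduce_walk arev (p @ reverse_walk p) = []"
  using reduce_walk_cancel[of p "[]"] by simp_all

lemma reduce_walk_cancel_middle:
  "reduce_walk arev (p @ reverse_walk q @ q @ r) = reduce_walk arev (p @ r)"
  "reduce_walk arev (p @ q @ reverse_walk q @ r) = reduce_walk arev (p @ r)"
  by (metis reduce_walk_append_right reduce_walk_cancel)+

lemma reduce_walk_snoc:
  assumes "reduced_walk arev p"
  shows "reduce_walk arev (p @ [e]) =
    (if p \<noteq> [] \<and> e = arev (last p) then butlast p else p @ [e])"
proof (cases "p \<noteq> [] \<and> e = arev (last p)")
  case True
  then obtain q where q: "p = q @ [arev e]"
    by (metis append_butlast_last_id arev_arev)
  have "reduced_walk arev q"
    using assms q by (auto simp: reduced_walk_snoc)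
  moreover have "act p [e] = act q []"
    by (simp add: q)
  ultimately show ?thesis
    using reduce_walk_reduced[of q] by (simp add: reduce_walk_act q)
next
  case False
  then show ?thesis
    using assms by (subst reduce_walk_reduced) (auto simp: reduced_walk_snoc)
qed

lemma awalk_reduce_walk_cons:
  assumes "awalk u (e # p) v" shows "awalk u (reduce_walk_cons arev e p) v"
proof (cases p)
  case (Cons f q)
  then show ?thesis
    using assms by (auto simp: awalk_simps)
qed (use assms in simp)

lemma awalk_reduce_walk: "awalk u p v \<Longrightarrow> awalk u (reduce_walk arev p) v"
proof (induction p arbitrary: u)
  case (Cons e p)
  then have "awalk u (e # reduce_walk arev p) v"
    by (auto simp: awalk_simps)
  from awalk_reduce_walk_cons[OF this] show ?case
    by (simp add: reduce_walk_act)
qed simp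

lemma awalk_reverse_walk: "awalk u p v \<Longrightarrow> awalk v (reverse_walk p) u"
proof (induction p arbitrary: u)
  case (Cons e p)
  then have "awalk v (reverse_walk p) (head G e)" "e \<in> arcs G" "tail G e = u"
    by (auto simp: awalk_Cons_iff)
  then have "awalk v (reverse_walk p @ [arev e]) u"
    by (intro awalk_appendI) (auto simp: awalk_simps)
  then show ?case by simp
qed (simp add: awalk_Nil_iff)

definition homotopy_classes :: "'a \<Rightarrow> 'b list set" where
  "homotopy_classes u = {p. (\<exists>v. awalk u p v) \<and> reduced_walk arev p}"

lemma verts_universal_cover: "verts (universal_cover G arev u) = homotopy_classes u"
  by (simp add: universal_cover_def homotopy_classes_def)

lemma homotopy_classes_awalk:
  "p \<in> homotopy_classes u \<Longrightarrow> awalk u p (endpoint G u p)"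
  by (auto simp: homotopy_classes_def)

lemma homotopy_classesI:
  "awalk u p v \<Longrightarrow> reduce_walk arev p \<in> homotopy_classes u"
  by (auto simp: homotopy_classes_def intro: awalk_reduce_walk)

lemma endpoint_reduce_walk: "awalk u p v \<Longrightarrow> endpoint G u (reduce_walk arev p) = v"
  by (drule awalk_reduce_walk) (elim awalkE)

lemma reduce_walk_class: "p \<in> homotopy_classes u \<Longrightarrow> reduce_walk arev p = p"
  by (auto simp: homotopy_classes_def reduce_walk_reduced)

text \<open>\<open>extend p e\<close> is the other end of the lift of \<open>e\<close> that starts at \<open>p\<close>.\<close>

abbreviation extend :: "'b list \<Rightarrow> 'b \<Rightarrow> 'b list" where
  "extend p e \<equiv> reduce_walk arev (p @ [e])"

lemma awalk_extend:
  assumes "p \<in> homotopy_classes u" "e \<in> arcs G" "tail G e = endpoint G u p"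
  shows "awalk u (p @ [e]) (head G e)"
  using homotopy_classes_awalk[OF assms(1)] assms(2,3) by (auto simp: awalk_simps)

lemma extend_class:
  assumes "p \<in> homotopy_classes u" "e \<in> arcs G" "tail G e = endpoint G u p"
  shows "extend p e \<in> homotopy_classes u" "endpoint G u (extend p e) = head G e"
  using homotopy_classesI[OF awalk_extend[OF assms]] endpoint_reduce_walk[OF awalk_extend[OF assms]]
  by auto

lemma extend_arev:
  assumes "p \<in> homotopy_classes u"
  shows "extend (extend p e) (arev e) = p"
  using reduce_walk_append_right[of p "[e, arev e]"] reduce_walk_class[OF assms]
    reduce_walk_cancel_Nil(2)[of "[e]"]
  by (simp del: reduce_walk_append_right)

end

context bidirected_digraph
begin

section \<open>Homology classes of walks\<close>

text \<open>
  A choice of one arc from each pair of mutually inverse arcs: both arcs of a pair give the same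
  two-element set, hence the same chosen element.
\<close>

definition orientation :: "'b set" where
  "orientation = (\<lambda>e. SOME f. f \<in> {e, arev e}) ` arcs G"

lemma orientation_subset: "orientation \<subseteq> arcs G"
proof -
  have "(SOME f. f \<in> {e, arev e}) \<in> arcs G" if "e \<in> arcs G" for e
    using someI[of "\<lambda>f. f \<in> {e, arev e}" e] that by auto
  then show ?thesis by (auto simp: orientation_def)
qed

lemma orientation_iff:
  assumes "e \<in> arcs G" shows "arev e \<in> orientation \<longleftrightarrow> e \<notin> orientation"
proof -
  define r where "r e = (SOME f. f \<in> {e, arev e})" for e
  have r: "r e \<in> {e, arev e}" for e
    unfolding r_def by (rule someI) auto
  have swap: "r (arev e) = r e" for e
    by (simp add: r_def insert_commute)
  have mem: "e \<in> orientation \<longleftrightarrow> r e = e" if "e \<in> arcs G" for e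
  proof
    assume "e \<in> orientation"
    then obtain f where "f \<in> arcs G" "e = r f"
      by (auto simp: orientation_def r_def)
    then show "r e = e"
      using r[of f] swap[of f] by auto
  next
    assume "r e = e"
    moreover have "r e \<in> orientation"
      using that by (auto simp: orientation_def r_def)
    ultimately show "e \<in> orientation" by simp
  qed
  show ?thesis
    using mem[of e] mem[of "arev e"] r[of e] swap[of e] assms arev_neq[of e] by auto
qed

text \<open>
  The group of homology classes is realised inside the integer-valued functions on arcs, as those
  supported on the orientation.
\<close>

definition arc_class :: "'b \<Rightarrow> 'b \<Rightarrow> int" where
  "arc_class e = (\<lambda>y. if y \<in> orientation then of_bool (y = e) - of_bool (y = arev e) else 0)"

definition homology :: "'b list \<Rightarrow> 'b \<Rightarrow> int" where
  "homology p = sum_list (map arc_class p)"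

lemma arc_class_arev [simp]: "arc_class (arev e) = - arc_class e"
  by (auto simp: arc_class_def)

lemma homology_simps [simp]:
  "homology [] = 0" "homology (e # p) = arc_class e + homology p"
  "homology (p @ q) = homology p + homology q"
  by (simp_all add: homology_def)

lemma homology_reduce_walk_cons:
  "homology (reduce_walk_cons arev e p) = arc_class e + homology p"
  by (cases p) auto

lemma homology_reduce_walk [simp]: "homology (reduce_walk arev p) = homology p"
  unfolding reduce_walk_act by (induction p) (auto simp: homology_reduce_walk_cons)

lemma homology_reverse_walk [simp]: "homology (reverse_walk p) = - homology p"
  by (induction p) auto

text \<open>
  If the reverse of \<open>e\<close> did not occur in \<open>p\<close>, the coordinate of the edge of \<open>e\<close> would have the same
  sign in the homology of \<open>p\<close> as in \<open>arc_class e\<close>.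
\<close>

lemma homology_eq_arc_class_imp_mem:
  assumes "homology p = - arc_class e" "e \<in> arcs G"
  shows "arev e \<in> set p"
proof (rule ccontr)
  assume nin: "arev e \<notin> set p"
  show False
  proof (cases "e \<in> orientation")
    case True
    have "homology p e \<ge> 0"
      using nin by (induction p) (auto simp: arc_class_def True)
    then show False
      using True arev_neq[OF assms(2)] by (auto simp: assms(1) arc_class_def)
  next
    case False
    then have *: "arev e \<in> orientation"
      using orientation_iff[OF assms(2)] by simp
    have "homology p (arev e) \<le> 0"
      using nin by (induction p) (auto simp: arc_class_def *)
    then show False
      using * arev_neq[OF assms(2)] by (auto simp: assms(1) arc_class_def)
  qed
qed

end

context comm_group
begin

definition list_mult :: "('c \<Rightarrow> 'a) \<Rightarrow> 'c list \<Rightarrow> 'a" where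
  "list_mult \<phi> xs = foldr (\<lambda>x a. \<phi> x \<otimes> a) xs \<one>"

lemma list_mult_simps [simp]:
  "list_mult \<phi> [] = \<one>" "list_mult \<phi> (x # xs) = \<phi> x \<otimes> list_mult \<phi> xs"
  by (simp_all add: list_mult_def)

lemma list_mult_closed [simp]: "\<phi> ` set xs \<subseteq> carrier G \<Longrightarrow> list_mult \<phi> xs \<in> carrier G"
  by (induction xs) auto

lemma list_mult_move:
  assumes "\<phi> ` set (xs @ x # ys) \<subseteq> carrier G"
  shows "list_mult \<phi> (xs @ x # ys) = \<phi> x \<otimes> list_mult \<phi> (xs @ ys)"
  using assms by (induction xs) (auto simp: m_lcomm)

end

text \<open>
  In an abelian group an arc and its reverse can be moved together and cancelled, and a list of zero
  homology always contains such a pair.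
\<close>

lemma (in bidirected_digraph) list_mult_homology_zero:
  assumes "comm_group Q"
    and "\<And>e. e \<in> arcs G \<Longrightarrow> \<phi> e \<in> carrier Q"
    and "\<And>e. e \<in> arcs G \<Longrightarrow> \<phi> e \<otimes>\<^bsub>Q\<^esub> \<phi> (arev e) = \<one>\<^bsub>Q\<^esub>"
    and "set p \<subseteq> arcs G" "homology p = 0"
  shows "comm_group.list_mult Q \<phi> p = \<one>\<^bsub>Q\<^esub>"
  using assms(4,5)
proof (induction "length p" arbitrary: p rule: less_induct)
  case less
  interpret Q: comm_group Q by fact
  show ?case
  proof (cases p)
    case (Cons e q)
    have e: "e \<in> arcs G" and q: "set q \<subseteq> arcs G"
      using less.prems Cons by auto
    have "homology q = - arc_class e"
      using less.prems Cons by (simp add: eq_neg_iff_add_eq_0 add.commute)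
    then have "arev e \<in> set q"
      using homology_eq_arc_class_imp_mem e by blast
    then obtain as bs where q_eq: "q = as @ arev e # bs"
      by (auto simp: in_set_conv_decomp)
    have carr: "\<phi> ` set q \<subseteq> carrier Q" "\<phi> ` set (as @ bs) \<subseteq> carrier Q"
      using q assms(2) by (auto simp: q_eq)
    have "Q.list_mult \<phi> p = \<phi> e \<otimes>\<^bsub>Q\<^esub> (\<phi> (arev e) \<otimes>\<^bsub>Q\<^esub> Q.list_mult \<phi> (as @ bs))"
      using Q.list_mult_move[of \<phi> as "arev e" bs] carr by (simp add: Cons q_eq)
    also have "\<dots> = Q.list_mult \<phi> (as @ bs)"
      using assms(2)[OF e] assms(2)[of "arev e"] assms(3)[OF e] e carr(2)
      by (simp add: Q.m_assoc[symmetric] del: set_append)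
    also have "\<dots> = \<one>\<^bsub>Q\<^esub>"
      using less.prems by (intro less.hyps) (auto simp: Cons q_eq algebra_simps)
    finally show ?thesis .
  qed simp
qed

section \<open>The commutator subgroup of the fundamental group\<close>

locale based_graph = bidirected_digraph G arev + fin_digraph G
  for G :: "('v, 'e) pre_digraph" and arev +
  fixes v0 :: 'v
  assumes connected: "connected G" and base: "v0 \<in> verts G"
begin

lemma reachable_imp_walk:
  assumes "u \<in> verts G" "v \<in> verts G"
  shows "\<exists>p. awalk u p v"
proof -
  have "symmetric G"
    unfolding symmetric_def arcs_ends_def arc_to_ends_def
    by (rule symI) (force simp: image_iff intro: rev_bexI[OF arev_in_arcs])
  then have "u \<rightarrow>\<^sup>*\<^bsub>G\<^esub> v"
    using assms connected reachable_mk_symmetric_eq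
    by (auto simp: connected_def strongly_connected_def)
  then show ?thesis
    by (simp add: reachable_awalk)
qed

abbreviation \<pi> :: "'e list monoid" where
  "\<pi> \<equiv> pi1 G arev v0"

lemma carrier_pi1: "p \<in> carrier \<pi> \<longleftrightarrow> awalk v0 p v0 \<and> reduced_walk arev p"
  by (simp add: pi1_def)

lemma pi1_simps [simp]:
  "p \<otimes>\<^bsub>\<pi>\<^esub> q = reduce_walk arev (p @ q)" "\<one>\<^bsub>\<pi>\<^esub> = []"
  by (simp_all add: pi1_def)

lemma reduce_walk_in_pi1: "awalk v0 p v0 \<Longrightarrow> reduce_walk arev p \<in> carrier \<pi>"
  by (simp add: carrier_pi1 awalk_reduce_walk)

lemma group_pi1: "group \<pi>"
proof (rule groupI)
  fix p q assume "p \<in> carrier \<pi>" "q \<in> carrier \<pi>"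
  then show "p \<otimes>\<^bsub>\<pi>\<^esub> q \<in> carrier \<pi>"
    by (auto simp: carrier_pi1 intro: awalk_appendI awalk_reduce_walk)
next
  fix p assume p: "p \<in> carrier \<pi>"
  then have "reduce_walk arev (reverse_walk p) \<in> carrier \<pi>"
    by (auto simp: carrier_pi1 intro: awalk_reduce_walk awalk_reverse_walk)
  then show "\<exists>q\<in>carrier \<pi>. q \<otimes>\<^bsub>\<pi>\<^esub> p = \<one>\<^bsub>\<pi>\<^esub>"
    by force
next
  show "\<one>\<^bsub>\<pi>\<^esub> \<in> carrier \<pi>"
    using base by (auto simp: carrier_pi1 awalk_Nil_iff)
qed (auto simp: carrier_pi1 reduce_walk_reduced)

interpretation pi1: group \<pi>
  by (rule group_pi1)

lemma homology_pi1_inv: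
  assumes "p \<in> carrier \<pi>" shows "homology (inv\<^bsub>\<pi>\<^esub> p) = - homology p"
proof -
  have "homology (p \<otimes>\<^bsub>\<pi>\<^esub> inv\<^bsub>\<pi>\<^esub> p) = 0"
    using assms by (subst pi1.r_inv) auto
  then show ?thesis
    by (simp add: eq_neg_iff_add_eq_0 add.commute)
qed

lemma derived_pi1_homology:
  "derived \<pi> (carrier \<pi>) \<subseteq> {p \<in> carrier \<pi>. homology p = 0}"
  unfolding derived_def
proof (rule pi1.generate_subgroup_incl)
  show "subgroup {p \<in> carrier \<pi>. homology p = 0} \<pi>"
  proof
    fix p q assume "p \<in> {p \<in> carrier \<pi>. homology p = 0}" "q \<in> {p \<in> carrier \<pi>. homology p = 0}"
    then show "p \<otimes>\<^bsub>\<pi>\<^esub> q \<in> {p \<in> carrier \<pi>. homology p = 0}"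
      using pi1.m_closed[of p q] by simp
  next
    fix p assume "p \<in> {p \<in> carrier \<pi>. homology p = 0}"
    then show "inv\<^bsub>\<pi>\<^esub> p \<in> {p \<in> carrier \<pi>. homology p = 0}"
      by (simp add: homology_pi1_inv)
  qed (use pi1.one_closed in auto)
  have "homology (p \<otimes>\<^bsub>\<pi>\<^esub> q \<otimes>\<^bsub>\<pi>\<^esub> inv\<^bsub>\<pi>\<^esub> p \<otimes>\<^bsub>\<pi>\<^esub> inv\<^bsub>\<pi>\<^esub> q) = 0"
    if "p \<in> carrier \<pi>" "q \<in> carrier \<pi>" for p q
    using that by (simp add: homology_pi1_inv)
  then show "derived_set \<pi> (carrier \<pi>) \<subseteq> {p \<in> carrier \<pi>. homology p = 0}"
    using pi1.derived_set_in_carrier[of "carrier \<pi>"] by (auto simp del: pi1_simps)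
qed

text \<open>
  The converse inclusion, which says that the abelianised fundamental group embeds in the lattice.
  Closing up every arc with fixed walks to and from the base vertex turns it into a loop, and a
  closed walk is homotopic to the product of the loops of its arcs.  In the abelian quotient that
  product is trivial as soon as the homology vanishes.
\<close>

lemma homology_zero_derived_pi1:
  assumes p: "p \<in> carrier \<pi>" and hom: "homology p = 0"
  shows "p \<in> derived \<pi> (carrier \<pi>)"
proof -
  define D where "D = derived \<pi> (carrier \<pi>)"
  interpret D: normal D \<pi>
    unfolding D_def using pi1.derived_self_is_normal by blast
  interpret Q: comm_group "\<pi> Mod D"
    unfolding D_def by (rule pi1.derived_quot_is_comm_group)
  \<comment> \<open>The empty walk at the base vertex makes \<open>loop v0 p v0\<close> equal to \<open>p\<close> itself.\<close>
  define \<tau> where "\<tau> v = (if v = v0 then [] else SOME q. awalk v0 q v)" for v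
  have \<tau>: "awalk v0 (\<tau> v) v" if "v \<in> verts G" for v
    using someI_ex[OF reachable_imp_walk[OF base that]] base by (auto simp: \<tau>_def awalk_Nil_iff)
  define loop where "loop u q v = reduce_walk arev (\<tau> u @ q @ reverse_walk (\<tau> v))" for u q v
  have loop: "loop u q v \<in> carrier \<pi>" if "awalk u q v" for u q v
    unfolding loop_def using that \<tau> awalk_hd_in_verts awalk_last_in_verts
    by (intro reduce_walk_in_pi1 awalk_appendI awalk_reverse_walk) blast+
  have loop_mult: "loop u q v \<otimes>\<^bsub>\<pi>\<^esub> loop v r w = loop u (q @ r) w" for u q v r w
    using reduce_walk_cancel_middle(1)[of "\<tau> u @ q" "\<tau> v" "r @ reverse_walk (\<tau> w)"]
      reduce_walk_append_right[of "\<tau> u @ q @ reverse_walk (\<tau> v)" "\<tau> v @ r @ reverse_walk (\<tau> w)"]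
    by (simp add: loop_def del: reduce_walk_append_right)
  define \<kappa> where "\<kappa> q = D #>\<^bsub>\<pi>\<^esub> q" for q
  have \<kappa>: "\<kappa> \<in> hom \<pi> (\<pi> Mod D)"
    unfolding \<kappa>_def by (rule D.r_coset_hom_Mod)
  have \<kappa>_one: "\<kappa> [] = \<one>\<^bsub>\<pi> Mod D\<^esub>"
    using \<kappa> group_hom.hom_one[of \<pi> "\<pi> Mod D" \<kappa>] by (simp add: group_hom_def group_hom_axioms_def)
  define \<phi> where "\<phi> e = \<kappa> (loop (tail G e) [e] (head G e))" for e
  have arc: "awalk (tail G e) [e] (head G e)" if "e \<in> arcs G" for e
    using that by (simp add: arc_implies_awalk)
  have \<phi>: "\<phi> e \<in> carrier (\<pi> Mod D)" if "e \<in> arcs G" for e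
    unfolding \<phi>_def using \<kappa> loop[OF arc[OF that]] by (auto simp: hom_def)
  have \<phi>_arev: "\<phi> e \<otimes>\<^bsub>\<pi> Mod D\<^esub> \<phi> (arev e) = \<one>\<^bsub>\<pi> Mod D\<^esub>" if "e \<in> arcs G" for e
  proof -
    have "\<phi> e \<otimes>\<^bsub>\<pi> Mod D\<^esub> \<phi> (arev e) = \<kappa> (loop (tail G e) [e, arev e] (tail G e))"
      using hom_mult[OF \<kappa> loop[OF arc] loop[OF arc], of e "arev e"] that
      by (simp add: \<phi>_def loop_mult del: pi1_simps)
    also have "loop (tail G e) [e, arev e] (tail G e) = []"
      unfolding loop_def
      using reduce_walk_cancel_middle(2)[of "\<tau> (tail G e)" "[e]" "reverse_walk (\<tau> (tail G e))"]
      by simp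
    finally show ?thesis using \<kappa>_one by simp
  qed
  have walk: "\<kappa> (loop u q v) = Q.list_mult \<phi> q" if "awalk u q v" for u q v
    using that
  proof (induction q arbitrary: u)
    case Nil
    then show ?case using \<kappa>_one by (simp add: loop_def awalk_Nil_iff)
  next
    case (Cons e q)
    then have q: "awalk (head G e) q v" "e \<in> arcs G" "u = tail G e"
      by (auto simp: awalk_Cons_iff)
    have "\<kappa> (loop u (e # q) v) = \<phi> e \<otimes>\<^bsub>\<pi> Mod D\<^esub> \<kappa> (loop (head G e) q v)"
      using hom_mult[OF \<kappa> loop[OF arc[OF q(2)]] loop[OF q(1)]] loop_mult[of u "[e]" "head G e" q v]
      by (simp add: \<phi>_def q(3) del: pi1_simps)
    then show ?case using Cons.IH[OF q(1)] by simp
  qed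
  have "loop v0 p v0 = p"
    using p by (simp add: loop_def \<tau>_def carrier_pi1 reduce_walk_reduced)
  moreover have "Q.list_mult \<phi> p = \<one>\<^bsub>\<pi> Mod D\<^esub>"
    using p hom
    by (intro list_mult_homology_zero[OF Q.comm_group_axioms] \<phi> \<phi>_arev) (auto simp: carrier_pi1)
  ultimately have "\<kappa> p = \<one>\<^bsub>\<pi> Mod D\<^esub>"
    using walk[of v0 p v0] p by (simp add: carrier_pi1)
  then have "D #>\<^bsub>\<pi>\<^esub> p = D"
    by (simp add: \<kappa>_def FactGroup_def)
  then show ?thesis
    using pi1.rcos_self[OF p D.subgroup_axioms] by (simp add: D_def)
qed

lemma carrier_commutator_pi1:
  "carrier (commutator_pi1 G arev v0) = {p. awalk v0 p v0 \<and> reduced_walk arev p \<and> homology p = 0}"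
  using derived_pi1_homology homology_zero_derived_pi1
  by (auto simp: commutator_pi1_def carrier_pi1)

text \<open>
  The vertices of the abelian cover, described without reference to the group action.
\<close>

definition fibre :: "'e list \<Rightarrow> 'e list set" where
  "fibre p = {q \<in> homotopy_classes v0. endpoint G v0 q = endpoint G v0 p \<and> homology q = homology p}"

text \<open>
  Two walks with the same endpoint differ by a loop, and the loop lies in the commutator subgroup
  exactly if the walks have the same homology.
\<close>

lemma orbit_deck_vert:
  assumes p: "p \<in> homotopy_classes v0"
  shows "Group_Action.orbit (commutator_pi1 G arev v0) (deck_vert arev) p = fibre p"
proof (intro equalityI subsetI)
  fix q assume "q \<in> Group_Action.orbit (commutator_pi1 G arev v0) (deck_vert arev) p"
  then obtain g where g: "awalk v0 g v0" "homology g = 0" "q = reduce_walk arev (g @ p)"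
    by (auto simp: Group_Action.orbit_def carrier_commutator_pi1 deck_vert_def)
  have "awalk v0 (g @ p) (endpoint G v0 p)"
    using g homotopy_classes_awalk[OF p] by (auto intro: awalk_appendI)
  then show "q \<in> fibre p"
    using g by (simp add: fibre_def homotopy_classesI endpoint_reduce_walk)
next
  fix q assume q: "q \<in> fibre p"
  define g where "g = reduce_walk arev (q @ reverse_walk p)"
  have "awalk v0 (q @ reverse_walk p) v0"
    using q homotopy_classes_awalk[of q v0] homotopy_classes_awalk[OF p]
    by (auto simp: fibre_def intro: awalk_appendI awalk_reverse_walk)
  then have "g \<in> carrier (commutator_pi1 G arev v0)"
    using q awalk_reduce_walk by (simp add: g_def carrier_commutator_pi1 fibre_def del: awalk_append_iff)
  moreover have "deck_vert arev g p = q"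
    using reduce_walk_cancel_middle(1)[of q p "[]"] q
    by (auto simp: deck_vert_def g_def fibre_def reduce_walk_class)
  ultimately show "q \<in> Group_Action.orbit (commutator_pi1 G arev v0) (deck_vert arev) p"
    by (auto simp: Group_Action.orbit_def)
qed

lemma orbit_deck_arc:
  assumes p: "p \<in> homotopy_classes v0"
  shows "Group_Action.orbit (commutator_pi1 G arev v0) (deck_arc arev) (p, e) = fibre p \<times> {e}"
  using orbit_deck_vert[OF p] by (auto simp: Group_Action.orbit_def deck_arc_def)

end

section \<open>Schroedinger operators on the covers\<close>

text \<open>
  Regrouping the row of the matrix by arcs instead of by neighbours, so that parallel arcs and loops
  need no special treatment.
\<close>

lemma schroedinger_op_out_arcs:
  fixes H :: "('v, 'e) pre_digraph"
  assumes u: "u \<in> verts H" and fin: "finite {a \<in> arcs H. tail H a = u}"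
    and heads: "\<And>a. a \<in> arcs H \<Longrightarrow> tail H a = u \<Longrightarrow> head H a \<in> verts H"
  shows "schroedinger_op H w V f u =
    (\<Sum>a | a \<in> arcs H \<and> tail H a = u. w a * f (head H a)) + of_real (V u) * f u"
proof -
  define A where "A = {a \<in> arcs H. tail H a = u}"
  define F where "F = insert u (head H ` A)"
  have F: "finite F" "F \<subseteq> verts H"
    using assms by (auto simp: F_def A_def)
  have entry: "schroedinger_entry H w V u v =
      (\<Sum>a\<in>{a \<in> A. head H a = v}. w a) + (if u = v then of_real (V v) else 0)" for v
    unfolding schroedinger_entry_def A_def by (simp add: conj_assoc)
  have "schroedinger_entry H w V u v = 0" if "v \<notin> F" for v
  proof -
    have empty: "{a \<in> A. head H a = v} = {}" and "u \<noteq> v"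
      using that by (auto simp: F_def)
    then show ?thesis unfolding entry empty by simp
  qed
  then have "schroedinger_op H w V f u = (\<Sum>\<^sub>\<infinity>v\<in>F. schroedinger_entry H w V u v * f v)"
    unfolding schroedinger_op_def using F(2) by (intro infsum_cong_neutral) auto
  also have "\<dots> = (\<Sum>v\<in>F. schroedinger_entry H w V u v * f v)"
    using F(1) by simp
  also have "\<dots> = (\<Sum>v\<in>F. \<Sum>a\<in>{a \<in> A. head H a = v}. w a * f (head H a)) +
      (\<Sum>v\<in>F. if u = v then of_real (V v) * f v else 0)"
  proof -
    have "schroedinger_entry H w V u v * f v = (\<Sum>a\<in>{a \<in> A. head H a = v}. w a * f (head H a)) +
        (if u = v then of_real (V v) * f v else 0)" for v
      unfolding entry distrib_right sum_distrib_right by (auto intro: sum.cong)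
    then show ?thesis by (simp only: sum.distrib)
  qed
  also have "(\<Sum>v\<in>F. \<Sum>a\<in>{a \<in> A. head H a = v}. w a * f (head H a)) = (\<Sum>a\<in>A. w a * f (head H a))"
    using F(1) fin by (intro sum.group) (auto simp: F_def A_def)
  also have "(\<Sum>v\<in>F. if u = v then of_real (V v) * f v else 0) = of_real (V u) * f u"
    using F(1) by (simp add: F_def)
  finally show ?thesis by (simp add: A_def)
qed

lemma schroedinger_op_outside:
  assumes "u \<notin> verts H" "\<And>a. a \<in> arcs H \<Longrightarrow> tail H a \<in> verts H"
  shows "schroedinger_op H w V f u = 0"
proof -
  have "schroedinger_entry H w V u v = 0" if "v \<in> verts H" for v
  proof -
    have empty: "{a \<in> arcs H. tail H a = u \<and> head H a = v} = {}" and "u \<noteq> v"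
      using assms that by auto
    then show ?thesis unfolding schroedinger_entry_def empty by simp
  qed
  then show ?thesis unfolding schroedinger_op_def by (intro infsum_0) simp
qed

locale schroedinger_graph = based_graph G arev v0
  for G :: "('v, 'e) pre_digraph" and arev v0 +
  fixes w :: "'e \<Rightarrow> complex" and V :: "'v \<Rightarrow> real"
  assumes weights: "schroedinger_weights G arev w"
begin

lemma weight_arev: "e \<in> arcs G \<Longrightarrow> w (arev e) = cnj (w e)"
  using weights unfolding schroedinger_weights_def by (metis complex_cnj_cnj)

abbreviation outs :: "'v \<Rightarrow> 'e set" where
  "outs v \<equiv> {e \<in> arcs G. tail G e = v}"

text \<open>The base vertex is a parameter because path trees are rooted at other vertices than \<open>v0\<close>.\<close>

abbreviation H_uni :: "'v \<Rightarrow> ('e list \<Rightarrow> complex) \<Rightarrow> 'e list \<Rightarrow> complex" where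
  "H_uni u \<equiv> universal_op G arev u w V"

lemma universal_op_class:
  assumes p: "p \<in> homotopy_classes u"
  shows "H_uni u f p = (\<Sum>e\<in>outs (endpoint G u p). w e * f (extend p e)) +
    of_real (V (endpoint G u p)) * f p"
proof -
  let ?U = "universal_cover G arev u"
  have arcs: "{a \<in> arcs ?U. tail ?U a = p} = Pair p ` outs (endpoint G u p)"
    using p by (auto simp: universal_cover_def homotopy_classes_def)
  have "H_uni u f p = (\<Sum>a | a \<in> arcs ?U \<and> tail ?U a = p. (w \<circ> snd) a * f (head ?U a)) +
      of_real ((V \<circ> endpoint G u) p) * f p"
    unfolding universal_op_def
  proof (rule schroedinger_op_out_arcs)
    show "p \<in> verts ?U" using p by (simp add: verts_universal_cover)
    show "finite {a \<in> arcs ?U. tail ?U a = p}" unfolding arcs by simp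
    fix a assume "a \<in> arcs ?U" "tail ?U a = p"
    then have "a \<in> Pair p ` outs (endpoint G u p)" using arcs by blast
    then show "head ?U a \<in> verts ?U"
      using extend_class(1)[OF p] by (auto simp: universal_cover_def[of G arev u] homotopy_classes_def)
  qed
  also have "(\<Sum>a | a \<in> arcs ?U \<and> tail ?U a = p. (w \<circ> snd) a * f (head ?U a)) =
      (\<Sum>e\<in>outs (endpoint G u p). w e * f (extend p e))"
    unfolding arcs by (subst sum.reindex) (auto simp: inj_on_def universal_cover_def)
  finally show ?thesis by simp
qed

lemma universal_op_outside:
  assumes "p \<notin> homotopy_classes u"
  shows "H_uni u f p = 0"
  unfolding universal_op_def
  by (rule schroedinger_op_outside)
    (use assms in \<open>auto simp: universal_cover_def homotopy_classes_def\<close>)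

lemma mem_fibre: "p \<in> homotopy_classes v0 \<Longrightarrow> p \<in> fibre p"
  by (simp add: fibre_def)

lemma fibre_eq_iff:
  assumes "p \<in> homotopy_classes v0" "q \<in> homotopy_classes v0"
  shows "fibre p = fibre q \<longleftrightarrow> endpoint G v0 p = endpoint G v0 q \<and> homology p = homology q"
  using mem_fibre[OF assms(1)] mem_fibre[OF assms(2)] by (auto simp: fibre_def)

lemma verts_abelian_cover: "verts (abelian_cover G arev v0) = fibre ` homotopy_classes v0"
  by (auto simp: abelian_cover_def verts_universal_cover orbit_deck_vert)

lemma arcs_abelian_cover:
  "arcs (abelian_cover G arev v0) =
    {fibre p \<times> {e} | p e. p \<in> homotopy_classes v0 \<and> e \<in> outs (endpoint G v0 p)}"
proof -
  let ?orb = "Group_Action.orbit (commutator_pi1 G arev v0) (deck_arc arev)"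
  have "arcs (universal_cover G arev v0) = (SIGMA p:homotopy_classes v0. outs (endpoint G v0 p))"
    by (auto simp: universal_cover_def homotopy_classes_def)
  then have "arcs (abelian_cover G arev v0) =
      (\<lambda>a. ?orb a) ` (SIGMA p:homotopy_classes v0. outs (endpoint G v0 p))"
    by (simp add: abelian_cover_def)
  also have "\<dots> = (\<lambda>(p, e). fibre p \<times> {e}) ` (SIGMA p:homotopy_classes v0. outs (endpoint G v0 p))"
    by (intro image_cong) (auto simp: orbit_deck_arc)
  finally show ?thesis by auto
qed

lemma extend_fibre:
  assumes p: "p \<in> homotopy_classes v0" and e: "e \<in> outs (endpoint G v0 p)"
  shows "(\<lambda>q. extend q e) ` fibre p = fibre (extend p e)"
proof (intro equalityI subsetI)
  fix q assume "q \<in> (\<lambda>q. extend q e) ` fibre p"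
  then show "q \<in> fibre (extend p e)"
    using extend_class[of _ v0 e] p e by (auto simp: fibre_def)
next
  fix q assume q: "q \<in> fibre (extend p e)"
  have tail: "tail G (arev e) = endpoint G v0 q" and q': "q \<in> homotopy_classes v0"
    using q extend_class[OF p, of e] e by (auto simp: fibre_def)
  have "extend q (arev e) \<in> fibre p"
    using extend_class[OF q' _ tail] q e p extend_class[OF p, of e] by (auto simp: fibre_def)
  moreover have "extend (extend q (arev e)) e = q"
    using extend_arev[OF q', of "arev e"] by simp
  ultimately show "q \<in> (\<lambda>q. extend q e) ` fibre p" by force
qed

lemma abelian_op_fibre:
  assumes p: "p \<in> homotopy_classes v0"
  shows "abelian_op G arev v0 w V f (fibre p) =
    (\<Sum>e\<in>outs (endpoint G v0 p). w e * f (fibre (extend p e))) +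
    of_real (V (endpoint G v0 p)) * f (fibre p)"
proof -
  let ?A = "abelian_cover G arev v0"
  have ne: "fibre q \<noteq> {}" if "q \<in> homotopy_classes v0" for q
    using mem_fibre[OF that] by auto
  have tail: "tail ?A (fibre q \<times> {e}) = fibre q" if "q \<in> homotopy_classes v0" for q e
    using ne[OF that] by (auto simp: abelian_cover_def universal_cover_def)
  have head: "head ?A (fibre p \<times> {e}) = fibre (extend p e)" if "e \<in> outs (endpoint G v0 p)" for e
  proof -
    have "(\<lambda>(q, e). extend q e) ` (X \<times> {e}) = (\<lambda>q. extend q e) ` X" for X
      by force
    then show ?thesis
      using extend_fibre[OF p that] by (simp add: abelian_cover_def universal_cover_def)
  qed
  have arcs: "{a \<in> arcs ?A. tail ?A a = fibre p} = (\<lambda>e. fibre p \<times> {e}) ` outs (endpoint G v0 p)"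
    (is "?L = ?R")
  proof (intro equalityI subsetI)
    fix a assume "a \<in> ?L"
    then obtain q e where qe: "a = fibre q \<times> {e}" "q \<in> homotopy_classes v0"
        "e \<in> outs (endpoint G v0 q)" "tail ?A a = fibre p"
      by (auto simp: arcs_abelian_cover)
    then have "fibre q = fibre p" using tail by simp
    then show "a \<in> ?R" using qe fibre_eq_iff[OF qe(2) p] by auto
  next
    fix a assume "a \<in> ?R"
    then show "a \<in> ?L" using tail[OF p] p by (auto simp: arcs_abelian_cover)
  qed
  have "abelian_op G arev v0 w V f (fibre p) =
      (\<Sum>a | a \<in> arcs ?A \<and> tail ?A a = fibre p. (w \<circ> abelian_cover_arc) a * f (head ?A a)) +
      of_real ((V \<circ> abelian_cover_vert G v0) (fibre p)) * f (fibre p)"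
    unfolding abelian_op_def
  proof (rule schroedinger_op_out_arcs)
    show "fibre p \<in> verts ?A" using p by (simp add: verts_abelian_cover)
    show "finite {a \<in> arcs ?A. tail ?A a = fibre p}" unfolding arcs by simp
    fix a assume "a \<in> arcs ?A" "tail ?A a = fibre p"
    then have "a \<in> (\<lambda>e. fibre p \<times> {e}) ` outs (endpoint G v0 p)" using arcs by blast
    then show "head ?A a \<in> verts ?A"
      using head extend_class(1)[OF p] by (auto simp: verts_abelian_cover)
  qed
  also have "(\<Sum>a | a \<in> arcs ?A \<and> tail ?A a = fibre p. (w \<circ> abelian_cover_arc) a * f (head ?A a)) =
      (\<Sum>e\<in>outs (endpoint G v0 p). w e * f (fibre (extend p e)))"
  proof -
    have "inj_on (\<lambda>e. fibre p \<times> {e}) (outs (endpoint G v0 p))"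
      using ne[OF p] by (auto simp: inj_on_def)
    moreover have "abelian_cover_arc (fibre p \<times> {e}) = e" for e
      using ne[OF p] by (simp add: abelian_cover_arc_def)
    ultimately show ?thesis
      unfolding arcs using head by (simp add: sum.reindex)
  qed
  also have "(V \<circ> abelian_cover_vert G v0) (fibre p) = V (endpoint G v0 p)"
  proof -
    have "endpoint G v0 ` fibre p = {endpoint G v0 p}"
      using mem_fibre[OF p] by (auto simp: fibre_def)
    then show ?thesis by (simp add: abelian_cover_vert_def)
  qed
  finally show ?thesis by simp
qed

text \<open>
  In the coordinates given by endpoint and homology, following an arc \<open>e\<close> adds the constant vector
  \<open>arc_class e\<close>.  The lattice may be larger than the image of the abelian cover, in which case the
  system splits into components, and solutions can be extended by zero.
\<close>

definition lattice_solution :: "complex \<Rightarrow> ('v \<Rightarrow> ('e \<Rightarrow> int) \<Rightarrow> complex) \<Rightarrow> bool" where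
  "lattice_solution z g \<longleftrightarrow>
    (\<forall>v\<in>verts G. \<forall>x. (\<Sum>e\<in>outs v. w e * g (head G e) (x + arc_class e)) + of_real (V v) * g v x = z * g v x)"

text \<open>
  Square summability survives because the coordinates are injective on the abelian cover; it is
  recorded as a bound on finite partial sums.
\<close>

lemma abelian_eigenfunction_lattice_solution:
  assumes "eigenvalue_ell2 (verts (abelian_cover G arev v0)) (abelian_op G arev v0 w V) z"
  obtains g v x C where "lattice_solution z g" "v \<in> verts G" "g v x \<noteq> 0"
    "\<And>Y. finite Y \<Longrightarrow> (\<Sum>(v, x)\<in>Y. (cmod (g v x))\<^sup>2) \<le> C"
proof -
  let ?S = "verts (abelian_cover G arev v0)"
  obtain f where f: "f \<in> ell2 ?S" "f \<noteq> (\<lambda>_. 0)" "abelian_op G arev v0 w V f = (\<lambda>x. z * f x)"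
    using assms by (auto simp: eigenvalue_ell2_def)
  define pt where "pt p = (endpoint G v0 p, homology p)" for p
  define I where "I = pt ` homotopy_classes v0"
  define rep where "rep a = (SOME p. p \<in> homotopy_classes v0 \<and> pt p = a)" for a
  define g where "g v x = (if (v, x) \<in> I then f (fibre (rep (v, x))) else 0)" for v x
  have rep: "rep a \<in> homotopy_classes v0 \<and> pt (rep a) = a" if "a \<in> I" for a
    unfolding rep_def by (rule someI_ex) (use that in \<open>auto simp: I_def\<close>)
  have fibre_rep: "fibre (rep (pt p)) = fibre p" if "p \<in> homotopy_classes v0" for p
    using rep[of "pt p"] that by (subst fibre_eq_iff) (auto simp: I_def pt_def)
  have g_pt: "g (endpoint G v0 p) (homology p) = f (fibre p)" if "p \<in> homotopy_classes v0" for p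
    using fibre_rep[OF that] that by (auto simp: g_def I_def pt_def)
  have step: "pt (extend p e) = (head G e, homology p + arc_class e)"
    if "p \<in> homotopy_classes v0" "e \<in> outs (endpoint G v0 p)" for p e
    using extend_class(2)[OF that(1), of e] that(2) by (simp add: pt_def)
  have solution: "lattice_solution z g"
    unfolding lattice_solution_def
  proof (intro ballI allI)
    fix v x assume v: "v \<in> verts G"
    show "(\<Sum>e\<in>outs v. w e * g (head G e) (x + arc_class e)) + of_real (V v) * g v x = z * g v x"
    proof (cases "(v, x) \<in> I")
      case True
      then obtain p where p: "p \<in> homotopy_classes v0" "v = endpoint G v0 p" "x = homology p"
        by (auto simp: I_def pt_def)
      have "(\<Sum>e\<in>outs v. w e * g (head G e) (x + arc_class e)) =
          (\<Sum>e\<in>outs v. w e * f (fibre (extend p e)))"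
      proof (rule sum.cong)
        fix e assume e: "e \<in> outs v"
        have "extend p e \<in> homotopy_classes v0"
          using extend_class(1)[OF p(1)] e p(2) by simp
        from g_pt[OF this] step[OF p(1), of e] e p
        show "w e * g (head G e) (x + arc_class e) = w e * f (fibre (extend p e))"
          by (simp add: pt_def)
      qed simp
      moreover have "g v x = f (fibre p)" using g_pt p by simp
      ultimately show ?thesis
        using abelian_op_fibre[OF p(1), of f] fun_cong[OF f(3), of "fibre p"] p(2) by simp
    next
      case False
      have "(head G e, x + arc_class e) \<notin> I" if e: "e \<in> outs v" for e
      proof
        assume "(head G e, x + arc_class e) \<in> I"
        then obtain p where p: "p \<in> homotopy_classes v0" "head G e = endpoint G v0 p"
            "x + arc_class e = homology p"
          by (auto simp: I_def pt_def)
        have e': "arev e \<in> outs (endpoint G v0 p)" "head G (arev e) = v"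
          using e p(2) by auto
        have "extend p (arev e) \<in> homotopy_classes v0"
          using extend_class(1)[OF p(1), of "arev e"] e'(1) by simp
        moreover have "pt (extend p (arev e)) = (v, x)"
          unfolding step[OF p(1) e'(1)] e'(2) p(3)[symmetric] by simp
        ultimately have "extend p (arev e) \<in> homotopy_classes v0" "pt (extend p (arev e)) = (v, x)"
          by simp_all
        then show False using False by (force simp: I_def)
      qed
      then show ?thesis using False by (simp add: g_def)
    qed
  qed
  have bound: "(\<Sum>(v, x)\<in>Y. (cmod (g v x))\<^sup>2) \<le> (\<Sum>\<^sub>\<infinity>X\<in>?S. (cmod (f X))\<^sup>2)" if Y: "finite Y" for Y
  proof -
    have "(\<Sum>(v, x)\<in>Y. (cmod (g v x))\<^sup>2) = (\<Sum>a\<in>Y \<inter> I. (cmod (f (fibre (rep a))))\<^sup>2)"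
      using Y by (intro sum.mono_neutral_cong_right) (auto simp: g_def)
    also have "\<dots> = (\<Sum>X\<in>(\<lambda>a. fibre (rep a)) ` (Y \<inter> I). (cmod (f X))\<^sup>2)"
    proof (subst sum.reindex)
      show "inj_on (\<lambda>a. fibre (rep a)) (Y \<inter> I)"
      proof
        fix a b assume ab: "a \<in> Y \<inter> I" "b \<in> Y \<inter> I" "fibre (rep a) = fibre (rep b)"
        then have "pt (rep a) = pt (rep b)"
          using fibre_eq_iff[of "rep a" "rep b"] rep[of a] rep[of b] by (auto simp: pt_def)
        then show "a = b" using rep[of a] rep[of b] ab by auto
      qed
    qed simp
    also have "\<dots> \<le> (\<Sum>\<^sub>\<infinity>X\<in>?S. (cmod (f X))\<^sup>2)"
      using Y f(1) rep by (intro finite_sum_le_infsum) (auto simp: ell2_def verts_abelian_cover)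
    finally show ?thesis .
  qed
  have "\<exists>v x. v \<in> verts G \<and> g v x \<noteq> 0"
  proof -
    obtain X where X: "f X \<noteq> 0" using f(2) by auto
    then have "X \<in> ?S" using f(1) by (auto simp: ell2_def)
    then obtain p where p: "p \<in> homotopy_classes v0" "X = fibre p"
      by (auto simp: verts_abelian_cover)
    have "g (endpoint G v0 p) (homology p) \<noteq> 0" using g_pt p X by simp
    then show ?thesis
      using awalk_last_in_verts[OF homotopy_classes_awalk[OF p(1)]] by blast
  qed
  then obtain v x where "v \<in> verts G" "g v x \<noteq> 0" by blast
  with solution show thesis using bound by (rule that)
qed

end

section \<open>The norm and the spectral radius of symmetric operators\<close>

definition finsupp :: "'a set \<Rightarrow> ('a \<Rightarrow> complex) set" where
  "finsupp S = {f. finite {x. f x \<noteq> 0} \<and> {x. f x \<noteq> 0} \<subseteq> S}"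

definition sqnorm :: "'a set \<Rightarrow> ('a \<Rightarrow> complex) \<Rightarrow> real" where
  "sqnorm S f = (\<Sum>\<^sub>\<infinity>x\<in>S. (cmod (f x))\<^sup>2)"

definition ell2_inner :: "'a set \<Rightarrow> ('a \<Rightarrow> complex) \<Rightarrow> ('a \<Rightarrow> complex) \<Rightarrow> complex" where
  "ell2_inner S f g = (\<Sum>\<^sub>\<infinity>x\<in>S. f x * cnj (g x))"

lemma ell2_norm_sqnorm: "ell2_norm S f = sqrt (sqnorm S f)"
  by (simp add: ell2_norm_def sqnorm_def)

lemma finsupp_ell2: "f \<in> finsupp S \<Longrightarrow> f \<in> ell2 S"
  unfolding finsupp_def ell2_def
  by (auto intro!: finite_nonzero_values_imp_summable_on elim: rev_finite_subset)

lemma finsupp_lincomb: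
  assumes "f \<in> finsupp S" "g \<in> finsupp S"
  shows "(\<lambda>x. a * f x + b * g x) \<in> finsupp S"
proof -
  have "{x. a * f x + b * g x \<noteq> 0} \<subseteq> {x. f x \<noteq> 0} \<union> {x. g x \<noteq> 0}" by auto
  then show ?thesis
    using assms unfolding finsupp_def by (auto intro: rev_finite_subset)
qed

lemma sqnorm_finite:
  assumes "finite A" "A \<subseteq> S" "\<And>x. x \<in> S - A \<Longrightarrow> f x = 0"
  shows "sqnorm S f = (\<Sum>x\<in>A. (cmod (f x))\<^sup>2)"
proof -
  have "sqnorm S f = (\<Sum>\<^sub>\<infinity>x\<in>A. (cmod (f x))\<^sup>2)"
    unfolding sqnorm_def by (rule infsum_cong_neutral) (use assms in auto)
  then show ?thesis using assms(1) by simp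
qed

lemma ell2_inner_finite:
  assumes "finite A" "A \<subseteq> S" "\<And>x. x \<in> S - A \<Longrightarrow> f x * cnj (g x) = 0"
  shows "ell2_inner S f g = (\<Sum>x\<in>A. f x * cnj (g x))"
proof -
  have "ell2_inner S f g = (\<Sum>\<^sub>\<infinity>x\<in>A. f x * cnj (g x))"
    unfolding ell2_inner_def by (rule infsum_cong_neutral) (use assms in auto)
  then show ?thesis using assms(1) by simp
qed

lemma sqnorm_nonneg: "sqnorm S f \<ge> 0"
  by (simp add: sqnorm_def infsum_nonneg)

lemma sqnorm_scale: "sqnorm S (\<lambda>x. c * f x) = (cmod c)\<^sup>2 * sqnorm S f"
  unfolding sqnorm_def by (simp add: norm_mult power_mult_distrib infsum_cmult_right')

lemma sqnorm_pos:
  assumes "f \<in> finsupp S" "f x \<noteq> 0"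
  shows "sqnorm S f > 0"
  using assms
  by (subst sqnorm_finite[of "{x. f x \<noteq> 0}"])
    (auto simp: finsupp_def intro!: sum_pos2[of _ x])

lemma ell2_inner_self:
  assumes "f \<in> finsupp S" shows "ell2_inner S f f = of_real (sqnorm S f)"
proof -
  let ?A = "{x. f x \<noteq> 0}"
  have A: "finite ?A" "?A \<subseteq> S" using assms by (auto simp: finsupp_def)
  have "ell2_inner S f f = (\<Sum>x\<in>?A. f x * cnj (f x))"
    by (rule ell2_inner_finite[OF A]) auto
  also have "\<dots> = of_real (\<Sum>x\<in>?A. (cmod (f x))\<^sup>2)"
    by (simp only: of_real_sum complex_norm_square)
  also have "(\<Sum>x\<in>?A. (cmod (f x))\<^sup>2) = sqnorm S f"
    by (rule sqnorm_finite[OF A, symmetric]) auto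
  finally show ?thesis .
qed

lemma sqnorm_diff:
  assumes "f \<in> finsupp S" "g \<in> finsupp S"
  shows "sqnorm S (\<lambda>x. f x - of_real c * g x) =
    sqnorm S f - 2 * c * Re (ell2_inner S f g) + c\<^sup>2 * sqnorm S g"
proof -
  define A where "A = {x. f x \<noteq> 0} \<union> {x. g x \<noteq> 0}"
  have A: "finite A" "A \<subseteq> S" using assms by (auto simp: A_def finsupp_def)
  have pt: "(cmod (a - of_real c * b))\<^sup>2 = (cmod a)\<^sup>2 - 2 * c * Re (a * cnj b) + c\<^sup>2 * (cmod b)\<^sup>2" for a b
    unfolding cmod_power2 by (simp add: power2_eq_square algebra_simps)
  have "sqnorm S (\<lambda>x. f x - of_real c * g x) = (\<Sum>x\<in>A. (cmod (f x - of_real c * g x))\<^sup>2)"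
    using A by (intro sqnorm_finite) (auto simp: A_def)
  also have "\<dots> = (\<Sum>x\<in>A. (cmod (f x))\<^sup>2) - 2 * c * Re (\<Sum>x\<in>A. f x * cnj (g x)) + c\<^sup>2 * (\<Sum>x\<in>A. (cmod (g x))\<^sup>2)"
    unfolding pt by (simp only: sum.distrib sum_subtractf sum_distrib_left Re_sum)
  also have "(\<Sum>x\<in>A. (cmod (f x))\<^sup>2) = sqnorm S f"
    using A by (intro sqnorm_finite[symmetric]) (auto simp: A_def)
  also have "(\<Sum>x\<in>A. (cmod (g x))\<^sup>2) = sqnorm S g"
    using A by (intro sqnorm_finite[symmetric]) (auto simp: A_def)
  also have "(\<Sum>x\<in>A. f x * cnj (g x)) = ell2_inner S f g"
    using A by (intro ell2_inner_finite[symmetric]) (auto simp: A_def)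
  finally show ?thesis .
qed

text \<open>
  Let \<open>L\<close> be the norm of \<open>T\<close> on finitely supported functions and let \<open>f\<close> be a unit vector with
  \<open>\<parallel>T f\<parallel>\<close> close to \<open>L\<close>.  By symmetry
  \<open>\<parallel>T (T f) - L\<^sup>2 f\<parallel>\<^sup>2 = \<parallel>T (T f)\<parallel>\<^sup>2 - 2 L\<^sup>2 \<parallel>T f\<parallel>\<^sup>2 + L\<^sup>4 \<le> L\<^sup>2 (L\<^sup>2 - \<parallel>T f\<parallel>\<^sup>2)\<close>,
  which is close to \<open>0\<close>.  As \<open>T\<^sup>2 - L\<^sup>2 = (T - L) (T + L)\<close>, the operators \<open>T - L\<close> and \<open>T + L\<close> cannot both
  have bounded inverses.  The function \<open>f0\<close> is an eigenvector of a finite section of \<open>T\<close>, which gives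
  \<open>|z| \<le> L\<close>.
\<close>

lemma spectral_radius_ge:
  fixes T :: "('a \<Rightarrow> complex) \<Rightarrow> 'a \<Rightarrow> complex"
  assumes supp: "\<And>f. f \<in> finsupp S \<Longrightarrow> T f \<in> finsupp S"
    and lin: "\<And>f g a b. f \<in> finsupp S \<Longrightarrow> g \<in> finsupp S \<Longrightarrow>
      T (\<lambda>x. a * f x + b * g x) = (\<lambda>x. a * T f x + b * T g x)"
    and sym: "\<And>f g. f \<in> finsupp S \<Longrightarrow> g \<in> finsupp S \<Longrightarrow> ell2_inner S (T f) g = ell2_inner S f (T g)"
    and bdd: "\<And>f. f \<in> finsupp S \<Longrightarrow> sqnorm S (T f) \<le> C * sqnorm S f"
    and f0: "f0 \<in> finsupp S" "f0 x0 \<noteq> 0" "\<And>x. f0 x \<noteq> 0 \<Longrightarrow> T f0 x = z * f0 x"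
  shows "ereal (cmod z) \<le> spectral_radius_ell2 S T"
proof -
  \<comment> \<open>\<open>N\<close> is the square of the norm of \<open>T\<close> on finitely supported functions.\<close>
  define N where "N = (SUP f\<in>{f \<in> finsupp S. sqnorm S f = 1}. sqnorm S (T f))"
  have scale_T: "T (\<lambda>x. a * f x) = (\<lambda>x. a * T f x)" if "f \<in> finsupp S" for a f
    using lin[OF that that, of a 0] by simp
  have scale_supp: "(\<lambda>x. a * f x) \<in> finsupp S" if "f \<in> finsupp S" for a f
    using finsupp_lincomb[OF that that, of a 0] by simp
  have normalize: "\<exists>g. g \<in> finsupp S \<and> sqnorm S g = 1 \<and> sqnorm S (T g) = sqnorm S (T f) / sqnorm S f"
    if f: "f \<in> finsupp S" "sqnorm S f > 0" for f
  proof -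
    define c where "c = complex_of_real (1 / sqrt (sqnorm S f))"
    have c: "(cmod c)\<^sup>2 = 1 / sqnorm S f"
      using f(2) by (simp add: c_def norm_divide power_divide)
    show ?thesis
      using f scale_supp[OF f(1), of c] scale_T[OF f(1), of c]
      by (intro exI[of _ "\<lambda>x. c * f x"]) (simp add: sqnorm_scale c)
  qed
  have bdd_above: "bdd_above ((\<lambda>f. sqnorm S (T f)) ` {f \<in> finsupp S. sqnorm S f = 1})"
    using bdd by (intro bdd_aboveI[of _ C]) force
  have N_upper: "sqnorm S (T f) \<le> N * sqnorm S f" if f: "f \<in> finsupp S" for f
  proof (cases "sqnorm S f > 0")
    case True
    then obtain g where g: "g \<in> finsupp S" "sqnorm S g = 1" "sqnorm S (T g) = sqnorm S (T f) / sqnorm S f"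
      using normalize[OF f] by blast
    then have "sqnorm S (T f) / sqnorm S f \<le> N"
      unfolding N_def using cSUP_upper[OF _ bdd_above, of g] by simp
    then show ?thesis using True by (simp add: field_simps)
  next
    case False
    then have "sqnorm S f = 0" using sqnorm_nonneg[of S f] by simp
    then show ?thesis using bdd[OF f] by simp
  qed
  have f0_pos: "sqnorm S f0 > 0" by (rule sqnorm_pos[OF f0(1,2)])
  have "(cmod z)\<^sup>2 * sqnorm S f0 \<le> sqnorm S (T f0)"
  proof -
    let ?A = "{x. f0 x \<noteq> 0}"
    have "(cmod z)\<^sup>2 * sqnorm S f0 = (\<Sum>x\<in>?A. (cmod (z * f0 x))\<^sup>2)"
      using f0(1) by (subst sqnorm_finite[of ?A])
        (auto simp: finsupp_def sum_distrib_left norm_mult power_mult_distrib)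
    also have "\<dots> = (\<Sum>x\<in>?A. (cmod (T f0 x))\<^sup>2)"
      using f0(3) by (intro sum.cong) auto
    also have "\<dots> \<le> (\<Sum>\<^sub>\<infinity>x\<in>S. (cmod (T f0 x))\<^sup>2)"
      using f0(1) finsupp_ell2[OF supp[OF f0(1)]]
      by (intro finite_sum_le_infsum) (auto simp: finsupp_def ell2_def)
    finally show ?thesis by (simp add: sqnorm_def)
  qed
  also have "\<dots> \<le> N * sqnorm S f0" by (rule N_upper[OF f0(1)])
  finally have z_le: "(cmod z)\<^sup>2 \<le> N" using f0_pos by simp
  define L where "L = sqrt N"
  have N_nonneg: "N \<ge> 0" using z_le by (meson order_trans zero_le_power2)
  have L: "L \<ge> 0" "L\<^sup>2 = N" "cmod z \<le> L"
    using N_nonneg real_le_rsqrt[OF z_le] by (auto simp: L_def)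
  have "of_real L \<in> spectrum_ell2 S T \<or> - of_real L \<in> spectrum_ell2 S T"
  proof (rule ccontr)
    assume "\<not> ?thesis"
    then obtain R1 R2 where R: "bounded_op_ell2 S R1" "bounded_op_ell2 S R2"
      and R1: "\<And>f. f \<in> ell2 S \<Longrightarrow> R1 (\<lambda>x. T f x - of_real L * f x) = f"
      and R2: "\<And>f. f \<in> ell2 S \<Longrightarrow> R2 (\<lambda>x. T f x - (- of_real L) * f x) = f"
      unfolding spectrum_ell2_def by blast
    obtain C1 where C1: "\<And>f. f \<in> ell2 S \<Longrightarrow> ell2_norm S (R1 f) \<le> C1 * ell2_norm S f"
      using R(1) unfolding bounded_op_ell2_def by blast
    obtain C2 where C2: "\<And>f. f \<in> ell2 S \<Longrightarrow> ell2_norm S (R2 f) \<le> C2 * ell2_norm S f"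
      using R(2) unfolding bounded_op_ell2_def by blast
    define K where "K = (C2 * C1)\<^sup>2"
    have K: "K \<ge> 0" by (simp add: K_def)
    have bound: "1 \<le> K * (N * (N - sqnorm S (T f)))" if f: "f \<in> finsupp S" "sqnorm S f = 1" for f
    proof -
      define g where "g = (\<lambda>x. T f x + of_real L * f x)"
      define h where "h = (\<lambda>x. T (T f) x - of_real N * f x)"
      have g_supp: "g \<in> finsupp S"
        using finsupp_lincomb[OF supp[OF f(1)] f(1), of 1] by (simp add: g_def)
      have h_supp: "h \<in> finsupp S"
        using finsupp_lincomb[OF supp[OF supp[OF f(1)]] f(1), of 1 "- of_real N"] by (simp add: h_def)
      have "(\<lambda>x. T g x - of_real L * g x) = h"
        using lin[OF supp[OF f(1)] f(1), of 1 "of_real L"] L(2)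
        by (auto simp: g_def h_def fun_eq_iff algebra_simps power2_eq_square simp flip: of_real_mult)
      then have g_eq: "R1 h = g"
        using R1[OF finsupp_ell2[OF g_supp]] by simp
      have f_eq: "R2 g = f"
        using R2[OF finsupp_ell2[OF f(1)]] by (simp add: g_def)
      have g_le: "ell2_norm S g \<le> C1 * ell2_norm S h"
        using C1[OF finsupp_ell2[OF h_supp]] g_eq by simp
      have f_le: "ell2_norm S f \<le> C2 * ell2_norm S g"
        using C2[OF finsupp_ell2[OF g_supp]] f_eq by simp
      have nn: "ell2_norm S h \<ge> 0" "ell2_norm S g \<ge> 0"
        by (auto simp: ell2_norm_sqnorm sqnorm_nonneg)
      have "1 \<le> \<bar>C2\<bar> * ell2_norm S g"
        using f_le f(2) nn mult_right_mono[OF abs_ge_self[of C2] nn(2)]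
        by (simp add: ell2_norm_sqnorm)
      also have "\<dots> \<le> \<bar>C2\<bar> * (\<bar>C1\<bar> * ell2_norm S h)"
        using g_le mult_right_mono[OF abs_ge_self[of C1] nn(1)] by (intro mult_left_mono) auto
      finally have "1 \<le> (\<bar>C2\<bar> * (\<bar>C1\<bar> * ell2_norm S h))\<^sup>2"
        by (simp add: one_le_power)
      also have "\<dots> = K * sqnorm S h"
        by (simp add: K_def power_mult_distrib ell2_norm_sqnorm sqnorm_nonneg)
      also have "sqnorm S h = sqnorm S (T (T f)) - 2 * N * sqnorm S (T f) + N\<^sup>2"
        unfolding h_def sqnorm_diff[OF supp[OF supp[OF f(1)]] f(1)]
          sym[OF supp[OF f(1)] f(1)] ell2_inner_self[OF supp[OF f(1)]] by (simp add: f(2))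
      also have "K * \<dots> \<le> K * (N * (N - sqnorm S (T f)))"
        using N_upper[OF supp[OF f(1)]] K
        by (intro mult_left_mono) (auto simp: algebra_simps power2_eq_square)
      finally show ?thesis .
    qed
    \<comment> \<open>Any \<open>\<epsilon>\<close> with \<open>K * N * \<epsilon> < 1\<close> would do; adding \<open>1\<close> covers the case \<open>K * N = 0\<close>.\<close>
    define \<epsilon> where "\<epsilon> = 1 / (K * N + 1)"
    have KN: "K * N \<ge> 0" using N_nonneg K by simp
    have "\<epsilon> > 0" using KN by (simp add: \<epsilon>_def add_nonneg_pos)
    then have "N - \<epsilon> < (SUP f\<in>{f \<in> finsupp S. sqnorm S f = 1}. sqnorm S (T f))"
      by (simp add: N_def)
    then obtain f where f: "f \<in> finsupp S" "sqnorm S f = 1" "N - \<epsilon> < sqnorm S (T f)"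
      using less_cSUP_iff[OF _ bdd_above] normalize[OF f0(1) f0_pos] by blast
    have "1 \<le> (K * N) * (N - sqnorm S (T f))"
      using bound[OF f(1,2)] by (simp add: mult.assoc)
    also have "\<dots> \<le> (K * N) * \<epsilon>"
      using f(3) KN by (intro mult_left_mono) auto
    also have "\<dots> < 1" using KN by (simp add: \<epsilon>_def)
    finally show False by simp
  qed
  then have "ereal L \<le> spectral_radius_ell2 S T"
  proof
    assume "of_real L \<in> spectrum_ell2 S T"
    then show ?thesis unfolding spectral_radius_ell2_def using L(1) by (intro SUP_upper2) auto
  next
    assume "- of_real L \<in> spectrum_ell2 S T"
    then show ?thesis unfolding spectral_radius_ell2_def using L(1) by (intro SUP_upper2) auto
  qed
  then show ?thesis using L(3) by (meson ereal_less_eq(3) order_trans)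
qed

context schroedinger_graph
begin

abbreviation U :: "'v \<Rightarrow> 'e list set" where "U \<equiv> homotopy_classes"

lemma bij_betw_extend:
  assumes e: "e \<in> arcs G"
  shows "bij_betw (\<lambda>p. extend p e) {p \<in> U u. endpoint G u p = tail G e}
    {p \<in> U u. endpoint G u p = tail G (arev e)}"
proof (rule bij_betw_byWitness[where f' = "\<lambda>p. extend p (arev e)"])
  show "\<forall>p\<in>{p \<in> U u. endpoint G u p = tail G e}. extend (extend p e) (arev e) = p"
    using extend_arev by blast
  show "\<forall>p\<in>{p \<in> U u. endpoint G u p = tail G (arev e)}. extend (extend p (arev e)) e = p"
    using extend_arev[of _ u "arev e"] by simp
qed (use extend_class[of _ u e] extend_class[of _ u "arev e"] e in auto)

lemma universal_op_lincomb:
  "H_uni u (\<lambda>x. a * f x + b * g x) = (\<lambda>x. a * H_uni u f x + b * H_uni u g x)"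
proof
  fix p show "H_uni u (\<lambda>x. a * f x + b * g x) p = a * H_uni u f p + b * H_uni u g p"
    by (cases "p \<in> U u")
      (simp_all add: universal_op_class universal_op_outside algebra_simps sum.distrib sum_distrib_left)
qed

lemma universal_op_finsupp:
  assumes f: "f \<in> finsupp (U u)"
  shows "H_uni u f \<in> finsupp (U u)"
proof -
  let ?A = "{x. f x \<noteq> 0}"
  have sub: "{p. H_uni u f p \<noteq> 0} \<subseteq> ?A \<union> (\<Union>e\<in>arcs G. (\<lambda>p. extend p (arev e)) ` ?A)"
  proof
    fix p assume "p \<in> {p. H_uni u f p \<noteq> 0}"
    then have p: "p \<in> U u" and nz: "H_uni u f p \<noteq> 0"
      using universal_op_outside by auto
    from nz have "f p \<noteq> 0 \<or> (\<exists>e\<in>outs (endpoint G u p). f (extend p e) \<noteq> 0)"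
      by (auto simp: universal_op_class[OF p] intro!: sum.neutral)
    then show "p \<in> ?A \<union> (\<Union>e\<in>arcs G. (\<lambda>p. extend p (arev e)) ` ?A)"
    proof
      assume "\<exists>e\<in>outs (endpoint G u p). f (extend p e) \<noteq> 0"
      then obtain e where "e \<in> arcs G" "f (extend p e) \<noteq> 0" by auto
      then show ?thesis using extend_arev[OF p, of e] by force
    qed simp
  qed
  show ?thesis
    using f finite_subset[OF sub] universal_op_outside
    by (auto simp: finsupp_def)
qed

text \<open>
  Sorted by arcs of the finite graph, so that symmetry becomes the exchange of \<open>e\<close> with its reverse
  under the bijection \<open>bij_betw_extend\<close>.
\<close>

lemma ell2_inner_universal_op:
  assumes f: "f \<in> finsupp (U u)" and g: "g \<in> finsupp (U u)"
  shows "ell2_inner (U u) (H_uni u f) g =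
    (\<Sum>e\<in>arcs G. w e * (\<Sum>\<^sub>\<infinity>p\<in>{p \<in> U u. endpoint G u p = tail G e}. f (extend p e) * cnj (g p))) +
    ell2_inner (U u) (\<lambda>p. of_real (V (endpoint G u p)) * f p) g"
proof -
  define B where "B = {p. g p \<noteq> 0}"
  have B: "finite B" "B \<subseteq> U u" using g by (auto simp: B_def finsupp_def)
  have "ell2_inner (U u) (H_uni u f) g = (\<Sum>p\<in>B. H_uni u f p * cnj (g p))"
    using B by (intro ell2_inner_finite) (auto simp: B_def)
  also have "\<dots> = (\<Sum>p\<in>B. (\<Sum>e\<in>arcs G. if tail G e = endpoint G u p then w e * (f (extend p e) * cnj (g p)) else 0)
     + of_real (V (endpoint G u p)) * f p * cnj (g p))"
  proof (rule sum.cong)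
    fix p assume "p \<in> B"
    then have p: "p \<in> U u" using B by blast
    show "H_uni u f p * cnj (g p) = (\<Sum>e\<in>arcs G. if tail G e = endpoint G u p then w e * (f (extend p e) * cnj (g p)) else 0)
     + of_real (V (endpoint G u p)) * f p * cnj (g p)"
      by (simp add: universal_op_class[OF p] distrib_right sum_distrib_right mult.assoc
          flip: sum.inter_filter)
  qed simp
  also have "\<dots> = (\<Sum>e\<in>arcs G. \<Sum>p\<in>B. if tail G e = endpoint G u p then w e * (f (extend p e) * cnj (g p)) else 0)
     + (\<Sum>p\<in>B. of_real (V (endpoint G u p)) * f p * cnj (g p))"
    unfolding sum.distrib by (subst sum.swap) simp
  also have "(\<Sum>p\<in>B. of_real (V (endpoint G u p)) * f p * cnj (g p)) =
      ell2_inner (U u) (\<lambda>p. of_real (V (endpoint G u p)) * f p) g"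
    using B by (intro ell2_inner_finite[symmetric]) (auto simp: B_def)
  also have "(\<Sum>e\<in>arcs G. \<Sum>p\<in>B. if tail G e = endpoint G u p then w e * (f (extend p e) * cnj (g p)) else 0) =
    (\<Sum>e\<in>arcs G. w e * (\<Sum>\<^sub>\<infinity>p\<in>{p \<in> U u. endpoint G u p = tail G e}. f (extend p e) * cnj (g p)))"
  proof (rule sum.cong)
    fix e assume "e \<in> arcs G"
    have "(\<Sum>\<^sub>\<infinity>p\<in>{p \<in> U u. endpoint G u p = tail G e}. f (extend p e) * cnj (g p)) =
        (\<Sum>\<^sub>\<infinity>p\<in>{p\<in>B. tail G e = endpoint G u p}. f (extend p e) * cnj (g p))"
      using B by (intro infsum_cong_neutral) (auto simp: B_def)
    also have "\<dots> = (\<Sum>p\<in>B. if tail G e = endpoint G u p then f (extend p e) * cnj (g p) else 0)"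
      using B by (simp add: sum.inter_filter)
    finally show "(\<Sum>p\<in>B. if tail G e = endpoint G u p then w e * (f (extend p e) * cnj (g p)) else 0) =
        w e * (\<Sum>\<^sub>\<infinity>p\<in>{p \<in> U u. endpoint G u p = tail G e}. f (extend p e) * cnj (g p))"
      by (simp add: sum_distrib_left if_distrib cong: if_cong)
  qed simp
  finally show ?thesis .
qed

lemma ell2_inner_commute: "ell2_inner S f g = cnj (ell2_inner S g f)"
  unfolding ell2_inner_def infsum_cnj[symmetric] by (simp add: mult.commute)

lemma universal_op_symmetric:
  assumes f: "f \<in> finsupp (U u)" and g: "g \<in> finsupp (U u)"
  shows "ell2_inner (U u) (H_uni u f) g = ell2_inner (U u) f (H_uni u g)"
proof -
  let ?D = "\<lambda>e. {p \<in> U u. endpoint G u p = tail G e}"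
  have "(\<Sum>e\<in>arcs G. w e * (\<Sum>\<^sub>\<infinity>p\<in>?D e. f (extend p e) * cnj (g p))) =
      (\<Sum>e\<in>arcs G. w (arev e) * (\<Sum>\<^sub>\<infinity>p\<in>?D (arev e). f (extend p (arev e)) * cnj (g p)))"
    using arev_permutes_arcs by (rule sum.permute[unfolded comp_def])
  also have "\<dots> = (\<Sum>e\<in>arcs G. cnj (w e * (\<Sum>\<^sub>\<infinity>p\<in>?D e. g (extend p e) * cnj (f p))))"
  proof (rule sum.cong)
    fix e assume e: "e \<in> arcs G"
    have "(\<Sum>\<^sub>\<infinity>p\<in>?D (arev e). f (extend p (arev e)) * cnj (g p)) =
        (\<Sum>\<^sub>\<infinity>p\<in>?D e. f (extend (extend p e) (arev e)) * cnj (g (extend p e)))"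
      by (rule infsum_reindex_bij_betw[OF bij_betw_extend[OF e], symmetric])
    also have "\<dots> = (\<Sum>\<^sub>\<infinity>p\<in>?D e. cnj (g (extend p e) * cnj (f p)))"
      using extend_arev by (intro infsum_cong) auto
    also have "\<dots> = cnj (\<Sum>\<^sub>\<infinity>p\<in>?D e. g (extend p e) * cnj (f p))"
      by (rule infsum_cnj)
    finally show "w (arev e) * (\<Sum>\<^sub>\<infinity>p\<in>?D (arev e). f (extend p (arev e)) * cnj (g p)) =
        cnj (w e * (\<Sum>\<^sub>\<infinity>p\<in>?D e. g (extend p e) * cnj (f p)))"
      using weight_arev[OF e] by simp
  qed simp
  moreover have "ell2_inner (U u) (\<lambda>p. of_real (V (endpoint G u p)) * f p) g =
      cnj (ell2_inner (U u) (\<lambda>p. of_real (V (endpoint G u p)) * g p) f)"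
    unfolding ell2_inner_def infsum_cnj[symmetric] by (intro infsum_cong) simp
  ultimately show ?thesis
    unfolding ell2_inner_commute[of "U u" f] ell2_inner_universal_op[OF f g] ell2_inner_universal_op[OF g f]
    by simp
qed

lemma universal_op_bounded:
  "\<exists>C. \<forall>f\<in>finsupp (U u). sqnorm (U u) (H_uni u f) \<le> C * sqnorm (U u) f"
proof -
  define m where "m = real (card (arcs G))"
  define Vm where "Vm = (\<Sum>v\<in>verts G. (V v)\<^sup>2)"
  define Wm where "Wm = (\<Sum>e\<in>arcs G. (cmod (w e))\<^sup>2)"
  have "sqnorm (U u) (H_uni u f) \<le> (2 * m * Wm + 2 * Vm) * sqnorm (U u) f" if f: "f \<in> finsupp (U u)" for f
  proof -
    define B where "B = {p. H_uni u f p \<noteq> 0}"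
    have B: "finite B" "B \<subseteq> U u"
      using universal_op_finsupp[OF f] by (auto simp: B_def finsupp_def)
    have summ: "(\<lambda>p. (cmod (f p))\<^sup>2) summable_on U u"
      using finsupp_ell2[OF f] by (simp add: ell2_def)
    have part: "(\<Sum>p\<in>X. (cmod (f p))\<^sup>2) \<le> sqnorm (U u) f" if "finite X" "X \<subseteq> U u" for X
      unfolding sqnorm_def using that summ by (intro finite_sum_le_infsum) auto
    have pt: "(cmod (H_uni u f p))\<^sup>2 \<le>
        2 * m * (\<Sum>e\<in>arcs G. if tail G e = endpoint G u p then (cmod (w e))\<^sup>2 * (cmod (f (extend p e)))\<^sup>2 else 0) +
        2 * Vm * (cmod (f p))\<^sup>2" if p: "p \<in> U u" for p
    proof -
      let ?v = "endpoint G u p"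
      let ?a = "\<Sum>e\<in>outs ?v. cmod (w e) * cmod (f (extend p e))"
      have v: "?v \<in> verts G"
        using awalk_last_in_verts[OF homotopy_classes_awalk[OF p]] .
      have "cmod (H_uni u f p) \<le> ?a + \<bar>V ?v\<bar> * cmod (f p)"
        unfolding universal_op_class[OF p]
        by (rule norm_triangle_le) (auto intro!: add_mono sum_norm_le simp: norm_mult)
      then have "(cmod (H_uni u f p))\<^sup>2 \<le> (?a + \<bar>V ?v\<bar> * cmod (f p))\<^sup>2"
        by (rule power_mono) simp
      also have "\<dots> \<le> 2 * ?a\<^sup>2 + 2 * (\<bar>V ?v\<bar> * cmod (f p))\<^sup>2"
        using sum_squares_bound[of ?a "\<bar>V ?v\<bar> * cmod (f p)"] by (simp add: power2_sum)
      also have "?a\<^sup>2 \<le> card (outs ?v) * (\<Sum>e\<in>outs ?v. (cmod (w e) * cmod (f (extend p e)))\<^sup>2)"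
        using sum_squared_le_sum_of_squares[of "\<lambda>e. cmod (w e) * cmod (f (extend p e))" "outs ?v"]
        by (simp add: mult.commute)
      also have "\<dots> \<le> m * (\<Sum>e\<in>outs ?v. (cmod (w e) * cmod (f (extend p e)))\<^sup>2)"
        unfolding m_def by (intro mult_right_mono of_nat_mono card_mono sum_nonneg) auto
      also have "(\<Sum>e\<in>outs ?v. (cmod (w e) * cmod (f (extend p e)))\<^sup>2) =
          (\<Sum>e\<in>arcs G. if tail G e = ?v then (cmod (w e))\<^sup>2 * (cmod (f (extend p e)))\<^sup>2 else 0)"
        by (simp add: sum.inter_filter power_mult_distrib)
      also have "(\<bar>V ?v\<bar> * cmod (f p))\<^sup>2 \<le> Vm * (cmod (f p))\<^sup>2"
        unfolding power_mult_distrib Vm_def using v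
        by (intro mult_right_mono) (auto intro: member_le_sum)
      finally show ?thesis by (simp add: algebra_simps)
    qed
    have "sqnorm (U u) (H_uni u f) = (\<Sum>p\<in>B. (cmod (H_uni u f p))\<^sup>2)"
      using B by (intro sqnorm_finite) (auto simp: B_def)
    also have "\<dots> \<le> (\<Sum>p\<in>B. 2 * m * (\<Sum>e\<in>arcs G. if tail G e = endpoint G u p then (cmod (w e))\<^sup>2 * (cmod (f (extend p e)))\<^sup>2 else 0) +
        2 * Vm * (cmod (f p))\<^sup>2)"
      using pt B by (intro sum_mono) auto
    also have "\<dots> = 2 * m * (\<Sum>e\<in>arcs G. (cmod (w e))\<^sup>2 * (\<Sum>p\<in>{p\<in>B. tail G e = endpoint G u p}. (cmod (f (extend p e)))\<^sup>2)) +
        2 * Vm * (\<Sum>p\<in>B. (cmod (f p))\<^sup>2)"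
      unfolding sum.distrib sum_distrib_left[symmetric]
      using B(1) by (subst sum.swap) (simp add: sum.inter_filter[symmetric] sum_distrib_left)
    also have "\<dots> \<le> 2 * m * (\<Sum>e\<in>arcs G. (cmod (w e))\<^sup>2 * sqnorm (U u) f) + 2 * Vm * sqnorm (U u) f"
    proof (intro add_mono mult_left_mono sum_mono)
      fix e assume e: "e \<in> arcs G"
      let ?D = "{p\<in>B. tail G e = endpoint G u p}"
      have D: "?D \<subseteq> {p \<in> U u. endpoint G u p = tail G e}" using B by auto
      have "(\<Sum>p\<in>?D. (cmod (f (extend p e)))\<^sup>2) = (\<Sum>q\<in>(\<lambda>p. extend p e) ` ?D. (cmod (f q))\<^sup>2)"
        using bij_betw_extend[OF e, of u] D
        by (subst sum.reindex) (auto simp: bij_betw_def intro: inj_on_subset)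
      also have "\<dots> \<le> sqnorm (U u) f"
        using B D e extend_class(1)[of _ u e] by (intro part) auto
      finally show "(\<Sum>p\<in>?D. (cmod (f (extend p e)))\<^sup>2) \<le> sqnorm (U u) f" .
    qed (use part[OF B] in \<open>auto simp: m_def Vm_def intro: sum_nonneg\<close>)
    also have "\<dots> = (2 * m * Wm + 2 * Vm) * sqnorm (U u) f"
      by (simp only: Wm_def sum_distrib_right[symmetric] distrib_right mult.assoc)
    finally show ?thesis .
  qed
  then show ?thesis by blast
qed

lemma universal_spectral_radius_ge:
  assumes "f \<in> finsupp (U v0)" "f p \<noteq> 0" "\<And>p. f p \<noteq> 0 \<Longrightarrow> H_uni v0 f p = z * f p"
  shows "ereal (cmod z) \<le> spectral_radius_ell2 (verts (universal_cover G arev v0)) (H_uni v0)"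
proof -
  obtain C where C: "\<forall>f\<in>finsupp (U v0). sqnorm (U v0) (H_uni v0 f) \<le> C * sqnorm (U v0) f"
    using universal_op_bounded[of v0] by (elim exE)
  show ?thesis
    unfolding verts_universal_cover
  proof (rule spectral_radius_ge)
    show "sqnorm (U v0) (H_uni v0 f) \<le> C * sqnorm (U v0) f" if "f \<in> finsupp (U v0)" for f
      using C that by (rule bspec)
    show "f \<in> finsupp (U v0)" "f p \<noteq> 0" by (fact assms)+
    show "H_uni v0 f p = z * f p" if "f p \<noteq> 0" for p
      using that by (rule assms(3))
  qed (use universal_op_finsupp universal_op_lincomb universal_op_symmetric in blast)+
qed

end

context schroedinger_graph
begin

section \<open>The matching polynomial as a mean over signings\<close>

text \<open>
  A sign for every edge.  The value \<open>1\<close> outside the arcs makes the set finite.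
\<close>

definition signings :: "('e \<Rightarrow> complex) set" where
  "signings = {s. (\<forall>e. (e \<in> arcs G \<longrightarrow> s e \<in> {1, -1}) \<and> (e \<notin> arcs G \<longrightarrow> s e = 1)) \<and> (\<forall>e. s (arev e) = s e)}"

definition flip :: "'e \<Rightarrow> ('e \<Rightarrow> complex) \<Rightarrow> 'e \<Rightarrow> complex" where
  "flip e s = (\<lambda>x. if x = e \<or> x = arev e then - s x else s x)"

lemma finite_signings [simp]: "finite signings"
proof -
  have "finite {s :: 'e \<Rightarrow> complex. \<forall>e. (e \<in> arcs G \<longrightarrow> s e \<in> {1, -1}) \<and> (e \<notin> arcs G \<longrightarrow> s e = 1)}"
    by (rule finite_set_of_finite_funs) auto
  then show ?thesis by (rule rev_finite_subset) (auto simp: signings_def)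
qed

lemma one_signing: "(\<lambda>_. 1) \<in> signings"
  by (simp add: signings_def)

lemma arev_eq_swap: "arev x = y \<longleftrightarrow> x = arev y"
  by (metis arev_arev)

lemma flip_signing: "e \<in> arcs G \<Longrightarrow> s \<in> signings \<Longrightarrow> flip e s \<in> signings"
  by (auto simp: signings_def flip_def arev_eq_swap)

lemma flip_flip [simp]: "flip e (flip e s) = s"
  by (auto simp: flip_def)

text \<open>
  Flipping the sign of one edge is a bijection of the signings that negates every summand.
\<close>

lemma sum_signings_flip:
  assumes e: "e \<in> arcs G" and R: "\<And>s. R (flip e s) = R s"
  shows "(\<Sum>s\<in>signings. s e * R s) = 0"
proof -
  have "(\<Sum>s\<in>signings. s e * R s) = (\<Sum>s\<in>signings. flip e s e * R (flip e s))"
    by (rule sum.reindex_bij_witness[of _ "flip e" "flip e"]) (auto simp: flip_signing e)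
  also have "\<dots> = - (\<Sum>s\<in>signings. s e * R s)"
  proof -
    have "flip e s e = - s e" for s by (simp add: flip_def)
    then show ?thesis by (simp add: R sum_negf)
  qed
  finally show ?thesis by simp
qed

definition arcs_between :: "'v \<Rightarrow> 'v \<Rightarrow> 'e set" where
  "arcs_between u v = {e \<in> arcs G. tail G e = u \<and> head G e = v}"

lemma finite_arcs_between [simp]: "finite (arcs_between u v)"
  by (simp add: arcs_between_def)

definition char_entry :: "complex \<Rightarrow> ('e \<Rightarrow> complex) \<Rightarrow> 'v \<Rightarrow> 'v \<Rightarrow> complex" where
  "char_entry z s u v =
    (if u = v then z - of_real (V u) else 0) - (\<Sum>e\<in>arcs_between u v. s e * w e)"

lemma char_entry_flip:
  assumes "e \<in> arcs_between u v" "(i, j) \<noteq> (u, v)" "(i, j) \<noteq> (v, u)"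
  shows "char_entry z (flip e s) i j = char_entry z s i j"
proof -
  have "(\<Sum>f\<in>arcs_between i j. flip e s f * w f) = (\<Sum>f\<in>arcs_between i j. s f * w f)"
    using assms by (intro sum.cong) (auto simp: arcs_between_def flip_def)
  then show ?thesis by (simp add: char_entry_def)
qed

lemma sum_signings_char_entry:
  assumes "\<And>e s. e \<in> arcs_between u v \<Longrightarrow> R (flip e s) = R s"
  shows "(\<Sum>s\<in>signings. char_entry z s u v * R s) =
    (if u = v then z - of_real (V u) else 0) * (\<Sum>s\<in>signings. R s)"
proof -
  have "(\<Sum>s\<in>signings. (\<Sum>e\<in>arcs_between u v. s e * w e) * R s) =
      (\<Sum>e\<in>arcs_between u v. w e * (\<Sum>s\<in>signings. s e * R s))"
    unfolding sum_distrib_right sum_distrib_left by (subst sum.swap) (simp add: ac_simps)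
  also have "\<dots> = 0"
    using assms by (intro sum.neutral ballI) (simp add: sum_signings_flip arcs_between_def)
  finally show ?thesis
    by (simp add: char_entry_def left_diff_distrib sum_subtractf sum_distrib_left)
qed

text \<open>
  After multiplication of the two entries only the products of an arc with its own reverse survive:
  in all others some sign occurs exactly once.
\<close>

lemma sum_signings_char_entry_pair:
  assumes "u \<noteq> v" and R: "\<And>e s. e \<in> arcs_between u v \<Longrightarrow> R (flip e s) = R s"
  shows "(\<Sum>s\<in>signings. char_entry z s u v * (char_entry z s v u * R s)) =
    (\<Sum>e\<in>arcs_between u v. of_real ((cmod (w e))\<^sup>2)) * (\<Sum>s\<in>signings. R s)"
proof -
  have inner: "(\<Sum>s\<in>signings. s e * (char_entry z s v u * R s)) = - cnj (w e) * (\<Sum>s\<in>signings. R s)"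
    if e: "e \<in> arcs_between u v" for e
  proof -
    have e_arc: "e \<in> arcs G" and e': "arev e \<in> arcs_between v u"
      using e by (auto simp: arcs_between_def)
    define Q where "Q s = (\<Sum>f\<in>arcs_between v u - {arev e}. s f * w f) * R s" for s
    have "Q (flip e s) = Q s" for s
    proof -
      have "flip e s f = s f" if "f \<in> arcs_between v u - {arev e}" for f
        using that e assms(1) by (auto simp: flip_def arcs_between_def)
      then show ?thesis using R[OF e] by (simp add: Q_def)
    qed
    then have Q: "(\<Sum>s\<in>signings. s e * Q s) = 0"
      by (rule sum_signings_flip[OF e_arc])
    have "s e * (char_entry z s v u * R s) = - cnj (w e) * R s - s e * Q s" if s: "s \<in> signings" for s
    proof -
      have sq: "s e * s e = 1"
        using s e_arc by (auto simp: signings_def)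
      have entry: "char_entry z s v u = - (s e * cnj (w e)) - (\<Sum>f\<in>arcs_between v u - {arev e}. s f * w f)"
        using assms(1) e' s weight_arev[OF e_arc]
        by (simp add: char_entry_def sum.remove[of _ "arev e"] signings_def)
      have "s e * (char_entry z s v u * R s) = - (s e * s e) * cnj (w e) * R s - s e * Q s"
        unfolding entry Q_def by (simp add: algebra_simps)
      then show ?thesis by (simp add: sq)
    qed
    then have "(\<Sum>s\<in>signings. s e * (char_entry z s v u * R s)) =
        (\<Sum>s\<in>signings. - cnj (w e) * R s - s e * Q s)"
      by (rule sum.cong[OF refl])
    then show ?thesis
      using Q by (simp add: sum_subtractf sum_distrib_left)
  qed
  have "(\<Sum>s\<in>signings. char_entry z s u v * (char_entry z s v u * R s)) =
      - (\<Sum>s\<in>signings. \<Sum>e\<in>arcs_between u v. w e * (s e * (char_entry z s v u * R s)))"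
    using assms(1)
    by (simp add: char_entry_def[of z _ u v] sum_distrib_right sum_distrib_left sum_negf ac_simps)
  also have "\<dots> = - (\<Sum>e\<in>arcs_between u v. w e * (\<Sum>s\<in>signings. s e * (char_entry z s v u * R s)))"
    by (subst sum.swap) (simp add: sum_distrib_left)
  also have "\<dots> = (\<Sum>e\<in>arcs_between u v. w e * cnj (w e) * (\<Sum>s\<in>signings. R s))"
    by (simp add: inner sum_negf mult.assoc)
  also have "\<dots> = (\<Sum>e\<in>arcs_between u v. of_real ((cmod (w e))\<^sup>2)) * (\<Sum>s\<in>signings. R s)"
    by (simp only: sum_distrib_right complex_norm_square)
  finally show ?thesis .
qed

text \<open>
  The contribution of one permutation to the sum, over all signings, of the determinants of
  \<open>z - H\<close> restricted to \<open>S\<close>.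
\<close>

definition char_term :: "complex \<Rightarrow> 'v set \<Rightarrow> ('v \<Rightarrow> 'v) \<Rightarrow> complex" where
  "char_term z S p = (\<Sum>s\<in>signings. of_int (sign p) * (\<Prod>i\<in>S. char_entry z s i (p i)))"

text \<open>
  The value at \<open>z\<close> of the weighted matching polynomial of the subgraph induced on \<open>S\<close>, up to the
  factor \<open>card signings\<close>: by the recurrence \<open>matching_poly_insert\<close> only permutations that are
  products of disjoint transpositions along edges contribute.
\<close>

definition matching_poly :: "'v set \<Rightarrow> complex \<Rightarrow> complex" where
  "matching_poly S z = (\<Sum>p | p permutes S. char_term z S p)"

lemma matching_poly_signings:
  "matching_poly S z =
    (\<Sum>s\<in>signings. \<Sum>p | p permutes S. of_int (sign p) * (\<Prod>i\<in>S. char_entry z s i (p i)))"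
  unfolding matching_poly_def char_term_def by (rule sum.swap)

lemma matching_poly_empty: "matching_poly {} z \<noteq> 0"
  using one_signing by (auto simp: matching_poly_def char_term_def)

lemma char_term_fixed:
  assumes "finite S" "v \<notin> S" "p permutes S"
  shows "char_term z (insert v S) p = (z - of_real (V v)) * char_term z S p"
proof -
  have "p v = v" using assms permutes_not_in by metis
  have "(\<Prod>i\<in>S. char_entry z (flip e s) i (p i)) = (\<Prod>i\<in>S. char_entry z s i (p i))"
    if "e \<in> arcs_between v v" for e s
    using assms(2) by (intro prod.cong char_entry_flip[OF that]) auto
  then have "(\<Sum>s\<in>signings. char_entry z s v v * (\<Prod>i\<in>S. char_entry z s i (p i))) =
      (z - of_real (V v)) * (\<Sum>s\<in>signings. \<Prod>i\<in>S. char_entry z s i (p i))"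
    by (subst sum_signings_char_entry) auto
  then show ?thesis
    using assms \<open>p v = v\<close> by (simp add: char_term_def sum_distrib_left[symmetric])
qed

text \<open>
  The signs of the edges from \<open>v\<close> to \<open>u\<close> occur in the factor of \<open>v\<close> alone, because the cycle of \<open>p\<close>
  through \<open>v\<close> does not go back from \<open>u\<close> to \<open>v\<close>.
\<close>

lemma char_term_long_cycle:
  assumes "finite S" "v \<notin> S" "p v = u" "u \<in> S" "p u \<noteq> v"
  shows "char_term z (insert v S) p = 0"
proof -
  have "(\<Prod>i\<in>S. char_entry z (flip e s) i (p i)) = (\<Prod>i\<in>S. char_entry z s i (p i))"
    if "e \<in> arcs_between v u" for e s
    using assms by (intro prod.cong char_entry_flip[OF that]) auto
  moreover have "v \<noteq> u" using assms by auto
  ultimately have "(\<Sum>s\<in>signings. char_entry z s v u * (\<Prod>i\<in>S. char_entry z s i (p i))) = 0"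
    by (subst sum_signings_char_entry) auto
  then show ?thesis
    using assms by (simp add: char_term_def sum_distrib_left[symmetric])
qed

lemma char_term_two_cycle:
  assumes "finite S" "v \<notin> S" "u \<in> S" "r permutes S - {u}"
  shows "char_term z (insert v S) (Transposition.transpose v u \<circ> r) =
    - (\<Sum>e\<in>arcs_between v u. of_real ((cmod (w e))\<^sup>2)) * char_term z (S - {u}) r"
proof -
  let ?p = "Transposition.transpose v u \<circ> r"
  have uv: "v \<noteq> u" using assms by auto
  have r: "r v = v" "r u = u"
    using assms permutes_not_in[OF assms(4)] by auto
  have p: "?p v = u" "?p u = v"
    by (simp_all add: r)
  have p_eq: "?p i = r i" if "i \<in> S - {u}" for i
  proof -
    have "r i \<in> S - {u}" using that permutes_in_image[OF assms(4)] by blast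
    then show ?thesis using assms(2) by (auto simp: Transposition.transpose_def)
  qed
  have sign: "sign ?p = - sign r"
  proof -
    have "permutation r"
      using assms(1,4) permutation_permutes by (metis finite_Diff)
    then show ?thesis
      using uv by (subst sign_compose) (auto simp: permutation_swap_id sign_swap_id)
  qed
  have "(\<Prod>i\<in>S - {u}. char_entry z (flip e s) i (r i)) = (\<Prod>i\<in>S - {u}. char_entry z s i (r i))"
    if "e \<in> arcs_between v u" for e s
    using assms(2) by (intro prod.cong char_entry_flip[OF that]) auto
  then have *: "(\<Sum>s\<in>signings. char_entry z s v u * (char_entry z s u v * (\<Prod>i\<in>S - {u}. char_entry z s i (r i)))) =
      (\<Sum>e\<in>arcs_between v u. of_real ((cmod (w e))\<^sup>2)) * (\<Sum>s\<in>signings. \<Prod>i\<in>S - {u}. char_entry z s i (r i))"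
    by (rule sum_signings_char_entry_pair[OF uv])
  have prod: "(\<Prod>i\<in>insert v S. char_entry z s i (?p i)) =
      char_entry z s v u * (char_entry z s u v * (\<Prod>i\<in>S - {u}. char_entry z s i (r i)))" for s
  proof -
    have "(\<Prod>i\<in>insert v S. char_entry z s i (?p i)) =
        char_entry z s v (?p v) * (char_entry z s u (?p u) * (\<Prod>i\<in>S - {u}. char_entry z s i (?p i)))"
      using assms(1-3) by (simp add: prod.remove[of S u])
    also have "(\<Prod>i\<in>S - {u}. char_entry z s i (?p i)) = (\<Prod>i\<in>S - {u}. char_entry z s i (r i))"
      using p_eq by (intro prod.cong) auto
    finally show ?thesis by (simp only: p)
  qed
  show ?thesis
    unfolding char_term_def prod sign using *
    by (simp add: sum_negf sum_distrib_left[symmetric] mult.left_commute)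
qed

text \<open>
  The classical recurrence: either \<open>v\<close> is unmatched or it is matched along one of its arcs.  On the
  level of permutations, \<open>v\<close> is fixed or lies on a two-cycle, since longer cycles average out.
\<close>

lemma matching_poly_insert:
  assumes S: "finite S" "v \<notin> S"
  shows "matching_poly (insert v S) z = (z - of_real (V v)) * matching_poly S z -
    (\<Sum>e | e \<in> outs v \<and> head G e \<in> S. of_real ((cmod (w e))\<^sup>2) * matching_poly (S - {head G e}) z)"
proof -
  let ?P = "{p. p permutes insert v S}"
  let ?t = "char_term z (insert v S)"
  have fin: "finite ?P" using S by (intro finite_permutations) simp
  have fixed: "{p\<in>?P. p v = v} = {p. p permutes S}"
  proof (intro equalityI subsetI)
    fix p assume "p \<in> {p\<in>?P. p v = v}"
    then show "p \<in> {p. p permutes S}"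
      using permutes_superset[of p "insert v S" S] by auto
  next
    fix p assume "p \<in> {p. p permutes S}"
    then show "p \<in> {p\<in>?P. p v = v}"
      using S(2) permutes_subset[of p S "insert v S"] permutes_not_in[of p S v] by auto
  qed
  have moved: "(\<Sum>p\<in>{p\<in>?P. p v = u}. ?t p) =
      - (\<Sum>e\<in>arcs_between v u. of_real ((cmod (w e))\<^sup>2)) * matching_poly (S - {u}) z"
    if u: "u \<in> S" for u
  proof -
    have uv: "u \<noteq> v" using u S by auto
    have "(\<Sum>p\<in>{p\<in>?P. p v = u}. ?t p) = (\<Sum>p\<in>{p\<in>?P. p v = u \<and> p u = v}. ?t p)"
      using fin char_term_long_cycle[OF S] u by (intro sum.mono_neutral_right) auto
    also have "\<dots> = (\<Sum>r | r permutes S - {u}. ?t (Transposition.transpose v u \<circ> r))"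
    proof (rule sum.reindex_bij_witness[of _ "\<lambda>r. Transposition.transpose v u \<circ> r" "\<lambda>p. Transposition.transpose v u \<circ> p"])
      fix p assume p: "p \<in> {p\<in>?P. p v = u \<and> p u = v}"
      show "Transposition.transpose v u \<circ> (Transposition.transpose v u \<circ> p) = p" by (simp add: fun_eq_iff)
      then show "?t (Transposition.transpose v u \<circ> (Transposition.transpose v u \<circ> p)) = ?t p" by simp
      have "Transposition.transpose v u \<circ> p permutes insert v S"
        using p u by (intro permutes_compose permutes_swap_id) auto
      then have "Transposition.transpose v u \<circ> p permutes S - {u}"
        by (rule permutes_superset) (use p in auto)
      then show "Transposition.transpose v u \<circ> p \<in> {r. r permutes S - {u}}"
        by simp
    next
      fix r assume "r \<in> {r. r permutes S - {u}}"
      then have r: "r permutes S - {u}" by simp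
      show "Transposition.transpose v u \<circ> (Transposition.transpose v u \<circ> r) = r" by (simp add: fun_eq_iff)
      have "r permutes insert v S" by (rule permutes_subset[OF r]) auto
      then have "Transposition.transpose v u \<circ> r permutes insert v S"
        using u by (intro permutes_compose permutes_swap_id) auto
      moreover have "r v = v" "r u = u"
        using S(2) permutes_not_in[OF r] by auto
      ultimately show "Transposition.transpose v u \<circ> r \<in> {p\<in>?P. p v = u \<and> p u = v}" by simp
    qed
    also have "\<dots> = - (\<Sum>e\<in>arcs_between v u. of_real ((cmod (w e))\<^sup>2)) * matching_poly (S - {u}) z"
      unfolding matching_poly_def sum_distrib_left
      using char_term_two_cycle[OF S u] by (intro sum.cong) auto
    finally show ?thesis .
  qed
  have "matching_poly (insert v S) z = (\<Sum>u\<in>insert v S. \<Sum>p\<in>{p\<in>?P. p v = u}. ?t p)"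
    unfolding matching_poly_def
    using S fin permutes_in_image[of _ "insert v S" v]
    by (intro sum.group[symmetric]) auto
  also have "\<dots> = (\<Sum>p | p permutes S. ?t p) + (\<Sum>u\<in>S. \<Sum>p\<in>{p\<in>?P. p v = u}. ?t p)"
    by (simp only: sum.insert[OF S] fixed)
  also have "(\<Sum>p | p permutes S. ?t p) = (z - of_real (V v)) * matching_poly S z"
    unfolding matching_poly_def sum_distrib_left using char_term_fixed[OF S] by (intro sum.cong) auto
  also have "(\<Sum>u\<in>S. \<Sum>p\<in>{p\<in>?P. p v = u}. ?t p) =
      (\<Sum>u\<in>S. - (\<Sum>e\<in>arcs_between v u. of_real ((cmod (w e))\<^sup>2)) * matching_poly (S - {u}) z)"
    using moved by (rule sum.cong[OF refl])
  also have "\<dots> = - (\<Sum>u\<in>S. \<Sum>e\<in>{e \<in> {e. e \<in> outs v \<and> head G e \<in> S}. head G e = u}.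
      of_real ((cmod (w e))\<^sup>2) * matching_poly (S - {head G e}) z)"
    unfolding sum_negf[symmetric] sum_distrib_right minus_mult_left[symmetric]
    by (intro sum.cong refl arg_cong[of _ _ uminus]) (auto simp: arcs_between_def)
  also have "\<dots> = - (\<Sum>e | e \<in> outs v \<and> head G e \<in> S. of_real ((cmod (w e))\<^sup>2) * matching_poly (S - {head G e}) z)"
    using S(1) by (subst sum.group) auto
  finally show ?thesis by simp
qed

section \<open>The path tree inside the universal cover\<close>

lemma apath_reduced:
  assumes "distinct (awalk_verts u p)" "cas u p v" "set p \<subseteq> arcs G"
  shows "reduced_walk arev p"
  using assms
proof (induction p arbitrary: u)
  case (Cons e p)
  show ?case
  proof (cases p)
    case (Cons f q)
    have "head G f \<in> set (awalk_verts (head G f) q)"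
      by (cases q) (use Cons.prems \<open>p = f # q\<close> in auto)
    then have "f \<noteq> arev e"
      using Cons.prems \<open>p = f # q\<close> by auto
    then show ?thesis
      using Cons.IH[of "head G e"] Cons.prems \<open>p = f # q\<close> by auto
  qed simp
qed simp

definition path_weight :: "'e list \<Rightarrow> complex" where
  "path_weight p = (\<Prod>e\<leftarrow>p. w (arev e))"

text \<open>
  Godsil's eigenvector.  The self-avoiding walks in \<open>S\<close> from \<open>u\<close> are the vertices of the path tree;
  the value at such a walk is the matching polynomial of what remains of \<open>S\<close> after deletion of the
  walk.  The product of conjugate weights along the walk accounts for the phases of \<open>w\<close>.
\<close>

definition path_tree_fun :: "complex \<Rightarrow> 'v set \<Rightarrow> 'v \<Rightarrow> 'e list \<Rightarrow> complex" where
  "path_tree_fun z S u p =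
    (if (\<exists>v. apath u p v) \<and> set (awalk_verts u p) \<subseteq> S
     then path_weight p * matching_poly (S - set (awalk_verts u p)) z else 0)"

lemma apath_snoc:
  assumes "apath u p v" "e \<in> outs v"
  shows "(\<exists>x. apath u (p @ [e]) x) \<longleftrightarrow> head G e \<notin> set (awalk_verts u p)"
    "awalk_verts u (p @ [e]) = awalk_verts u p @ [head G e]"
proof -
  have walk: "awalk u (p @ [e]) (head G e)"
    using assms by (auto simp: apath_def awalk_simps)
  show verts: "awalk_verts u (p @ [e]) = awalk_verts u p @ [head G e]"
    using awalk_verts_append[OF walk] by simp
  show "(\<exists>x. apath u (p @ [e]) x) \<longleftrightarrow> head G e \<notin> set (awalk_verts u p)"
    using walk assms(1) unfolding apath_def verts by auto
qed

lemma apath_in_homotopy_classes: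
  assumes "apath u p v" shows "p \<in> homotopy_classes u" "endpoint G u p = v"
  using assms apath_reduced[of u p v] unfolding homotopy_classes_def
  by (auto simp: apath_def awalk_def)

lemma path_tree_fun_finsupp: "path_tree_fun z S u \<in> finsupp (U u)"
proof -
  have "{p. path_tree_fun z S u p \<noteq> 0} \<subseteq> (\<Union>v\<in>verts G. {p. apath u p v})"
    by (auto simp: path_tree_fun_def apath_def split: if_splits)
  moreover have "finite (\<Union>v\<in>verts G. {p. apath u p v})"
    using apaths_finite by auto
  ultimately have "finite {p. path_tree_fun z S u p \<noteq> 0}"
    by (rule finite_subset)
  then show ?thesis
    using apath_in_homotopy_classes(1) by (auto simp: finsupp_def path_tree_fun_def split: if_splits)
qed

text \<open>
  At a self-avoiding walk \<open>p\<close> ending at \<open>v\<close> let \<open>T\<close> be what remains of \<open>S\<close>.  The extensions of \<open>p\<close>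
  contribute the sum in the recurrence for \<open>T\<close> with \<open>v\<close> added, and the arc leading back along \<open>p\<close>
  contributes the left hand side of that recurrence.  At the root there is no arc leading back; there
  the left hand side is the matching polynomial of \<open>S\<close>, which is assumed to vanish.
\<close>

lemma path_tree_eigenfunction:
  assumes S: "S \<subseteq> verts G" "matching_poly S z = 0" and p: "path_tree_fun z S u p \<noteq> 0"
  shows "H_uni u (path_tree_fun z S u) p = z * path_tree_fun z S u p"
proof -
  let ?F = "path_tree_fun z S u"
  obtain v where v: "apath u p v" and sub: "set (awalk_verts u p) \<subseteq> S"
    using p by (auto simp: path_tree_fun_def split: if_splits)
  define T where "T = S - set (awalk_verts u p)"
  define c where "c = path_weight p"
  have fin: "finite T" using finite_subset[OF S(1)] by (simp add: T_def)
  have cls: "p \<in> U u" and end_p: "endpoint G u p = v"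
    using apath_in_homotopy_classes[OF v] by auto
  have red: "reduced_walk arev p" using cls by (simp add: homotopy_classes_def)
  have v_mem: "v \<in> set (awalk_verts u p)"
    using end_p last_in_set[of "awalk_verts u p"] by simp
  have Fp: "?F p = c * matching_poly T z"
    using v sub by (auto simp: path_tree_fun_def T_def c_def)
  define backtrack where "backtrack e \<longleftrightarrow> p \<noteq> [] \<and> e = arev (last p)" for e
  have back_head: "head G e \<in> set (awalk_verts u p)" if "backtrack e" for e
  proof -
    have "last p \<in> arcs G" "p \<noteq> []" "e = arev (last p)"
      using that v by (auto simp: backtrack_def apath_def awalk_def)
    then show ?thesis by (simp add: awalk_verts_conv)
  qed
  have step: "?F (extend p e) =
      (if head G e \<in> T then c * w (arev e) * matching_poly (T - {head G e}) z else 0) +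
      (if backtrack e then ?F (butlast p) else 0)" if e: "e \<in> outs v" for e
  proof (cases "backtrack e")
    case True
    then show ?thesis
      using reduce_walk_snoc[OF red, of e] back_head by (auto simp: backtrack_def T_def)
  next
    case False
    then have ext: "extend p e = p @ [e]"
      using reduce_walk_snoc[OF red, of e] by (auto simp: backtrack_def)
    have "S - set (awalk_verts u (p @ [e])) = T - {head G e}"
      unfolding apath_snoc(2)[OF v e] by (auto simp: T_def)
    then show ?thesis
      using False sub apath_snoc(1)[OF v e]
      by (auto simp: ext path_tree_fun_def apath_snoc(2)[OF v e] c_def path_weight_def T_def)
  qed
  have back_sum: "(\<Sum>e\<in>outs v. w e * (if backtrack e then ?F (butlast p) else 0)) =
      c * matching_poly (insert v T) z"
  proof (cases "p = []")
    case True
    then have "insert v T = S"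
      using v sub by (auto simp: T_def apath_def awalk_simps)
    then show ?thesis using S(2) True by (simp add: backtrack_def)
  next
    case False
    then obtain q l where ql: "p = q @ [l]"
      by (metis append_butlast_last_id)
    have l: "l \<in> arcs G" "head G l = v" "apath u q (tail G l)"
      using v by (auto simp: ql apath_append_iff apath_Cons_iff apath_Nil_iff)
    have l_out: "l \<in> outs (tail G l)" using l by simp
    have v_notin: "v \<notin> set (awalk_verts u q)"
      using apath_snoc(1)[OF l(3) l_out] v l(2) by (auto simp: ql)
    have verts_p: "awalk_verts u p = awalk_verts u q @ [v]"
      using apath_snoc(2)[OF l(3) l_out] l(2) by (simp add: ql)
    have "S - set (awalk_verts u q) = insert v T"
      using v_notin sub by (auto simp: T_def verts_p)
    then have Fq: "?F q = path_weight q * matching_poly (insert v T) z"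
      using l(3) sub by (auto simp: path_tree_fun_def verts_p)
    have "(\<Sum>e\<in>outs v. w e * (if backtrack e then ?F (butlast p) else 0)) =
        (\<Sum>e\<in>outs v. if e = arev l then w e * ?F q else 0)"
      by (intro sum.cong) (auto simp: backtrack_def ql)
    also have "\<dots> = w (arev l) * ?F q"
      using l by simp
    finally show ?thesis
      by (simp add: Fq c_def ql path_weight_def)
  qed
  have "H_uni u ?F p = (\<Sum>e\<in>outs v. w e * ?F (extend p e)) + of_real (V v) * ?F p"
    using universal_op_class[OF cls, of ?F] end_p by simp
  also have "(\<Sum>e\<in>outs v. w e * ?F (extend p e)) =
      (\<Sum>e\<in>outs v. if head G e \<in> T then c * (w e * w (arev e)) * matching_poly (T - {head G e}) z else 0) +
      (\<Sum>e\<in>outs v. w e * (if backtrack e then ?F (butlast p) else 0))"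
    unfolding sum.distrib[symmetric] by (rule sum.cong) (auto simp: step algebra_simps)
  also have "(\<Sum>e\<in>outs v. if head G e \<in> T then c * (w e * w (arev e)) * matching_poly (T - {head G e}) z else 0) =
      c * (\<Sum>e | e \<in> outs v \<and> head G e \<in> T. of_real ((cmod (w e))\<^sup>2) * matching_poly (T - {head G e}) z)"
  proof -
    have "(\<Sum>e\<in>outs v. if head G e \<in> T then c * (w e * w (arev e)) * matching_poly (T - {head G e}) z else 0) =
        (\<Sum>e | e \<in> outs v \<and> head G e \<in> T. c * (w e * w (arev e)) * matching_poly (T - {head G e}) z)"
      by (subst sum.inter_filter[symmetric]) auto
    also have "\<dots> = (\<Sum>e | e \<in> outs v \<and> head G e \<in> T. c * (of_real ((cmod (w e))\<^sup>2) * matching_poly (T - {head G e}) z))"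
      by (rule sum.cong) (simp_all only: complex_norm_square weight_arev mult.assoc, auto simp: weight_arev)
    finally show ?thesis by (simp only: sum_distrib_left)
  qed
  also note back_sum
  also have "matching_poly (insert v T) z = (z - of_real (V v)) * matching_poly T z -
      (\<Sum>e | e \<in> outs v \<and> head G e \<in> T. of_real ((cmod (w e))\<^sup>2) * matching_poly (T - {head G e}) z)"
    using v_mem by (intro matching_poly_insert fin) (simp add: T_def)
  finally show ?thesis by (simp add: Fp algebra_simps)
qed

lemma change_base:
  assumes q: "awalk u q v" and x: "x \<in> U u"
  shows "reduce_walk arev (reverse_walk q @ x) \<in> U v"
    "endpoint G v (reduce_walk arev (reverse_walk q @ x)) = endpoint G u x"
proof -
  have "awalk v (reverse_walk q @ x) (endpoint G u x)"
    using awalk_reverse_walk[OF q] homotopy_classes_awalk[OF x] by (rule awalk_appendI)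
  then show "reduce_walk arev (reverse_walk q @ x) \<in> U v"
    "endpoint G v (reduce_walk arev (reverse_walk q @ x)) = endpoint G u x"
    by (auto intro: homotopy_classesI endpoint_reduce_walk)
qed

text \<open>
  Composition with a fixed walk identifies the universal covers with different base vertices and
  intertwines the two operators.
\<close>

lemma change_base_eigenfunction:
  assumes q: "awalk u q v" and F: "F \<in> finsupp (U v)" "F y \<noteq> 0"
    and eig: "\<And>y. F y \<noteq> 0 \<Longrightarrow> H_uni v F y = z * F y"
  shows "\<exists>f x. f \<in> finsupp (U u) \<and> f x \<noteq> 0 \<and> (\<forall>x. f x \<noteq> 0 \<longrightarrow> H_uni u f x = z * f x)"
proof -
  define \<phi> where "\<phi> x = reduce_walk arev (reverse_walk q @ x)" for x
  define \<psi> where "\<psi> y = reduce_walk arev (q @ y)" for y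
  define f where "f x = (if x \<in> U u then F (\<phi> x) else 0)" for x
  note \<phi> = change_base[OF q, folded \<phi>_def]
  have q': "awalk v (reverse_walk q) u" by (rule awalk_reverse_walk[OF q])
  have \<psi>: "\<psi> y \<in> U u" if "y \<in> U v" for y
    using change_base(1)[OF q' that] by (simp add: \<psi>_def)
  have \<psi>\<phi>: "\<psi> (\<phi> x) = x" if "x \<in> U u" for x
    using reduce_walk_class[OF that] reduce_walk_append_right[of q "reverse_walk q @ x"]
    unfolding \<psi>_def \<phi>_def by (simp del: reduce_walk_append_right)
  have \<phi>\<psi>: "\<phi> (\<psi> y) = y" if "y \<in> U v" for y
    using reduce_walk_class[OF that] reduce_walk_append_right[of "reverse_walk q" "q @ y"]
    unfolding \<psi>_def \<phi>_def by (simp del: reduce_walk_append_right)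
  have "{x. f x \<noteq> 0} \<subseteq> \<psi> ` {y. F y \<noteq> 0}"
  proof
    fix x assume "x \<in> {x. f x \<noteq> 0}"
    then have "x \<in> U u" "F (\<phi> x) \<noteq> 0" by (auto simp: f_def split: if_splits)
    then show "x \<in> \<psi> ` {y. F y \<noteq> 0}"
      by (intro image_eqI[of _ _ "\<phi> x"]) (simp_all add: \<psi>\<phi>)
  qed
  moreover have "finite (\<psi> ` {y. F y \<noteq> 0})"
    using F(1) by (auto simp: finsupp_def)
  ultimately have "finite {x. f x \<noteq> 0}"
    by (rule finite_subset)
  then have "f \<in> finsupp (U u)"
    by (auto simp: finsupp_def f_def split: if_splits)
  moreover have "f (\<psi> y) \<noteq> 0"
  proof -
    have y: "y \<in> U v" using F by (auto simp: finsupp_def)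
    then show ?thesis using \<psi>[OF y] \<phi>\<psi>[OF y] F(2) by (simp add: f_def)
  qed
  moreover have "H_uni u f x = z * f x" if fx: "f x \<noteq> 0" for x
  proof -
    have x: "x \<in> U u" using fx by (auto simp: f_def split: if_splits)
    have ext: "f (extend x e) = F (extend (\<phi> x) e)" if e: "e \<in> outs (endpoint G u x)" for e
    proof -
      have "extend x e \<in> U u" using extend_class(1)[OF x] e by simp
      moreover have "\<phi> (extend x e) = extend (\<phi> x) e" by (simp add: \<phi>_def)
      ultimately show ?thesis by (simp add: f_def)
    qed
    have fx_eq: "f x = F (\<phi> x)" using x by (simp add: f_def)
    have "(\<Sum>e\<in>outs (endpoint G u x). w e * f (extend x e)) =
        (\<Sum>e\<in>outs (endpoint G u x). w e * F (extend (\<phi> x) e))"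
      by (rule sum.cong) (simp_all only: ext)
    then have "H_uni u f x = H_uni v F (\<phi> x)"
      unfolding universal_op_class[OF x] universal_op_class[OF \<phi>(1)[OF x]] \<phi>(2)[OF x] fx_eq by simp
    then show ?thesis using eig[of "\<phi> x"] fx x by (simp add: f_def)
  qed
  ultimately show ?thesis by blast
qed

text \<open>
  The set is first shrunk to a minimal one with vanishing matching polynomial, because then the
  eigenvector of the path tree is nonzero at the root.
\<close>

lemma matching_poly_root_bound:
  assumes "S \<subseteq> verts G" "matching_poly S z = 0"
  shows "ereal (cmod z) \<le> spectral_radius_ell2 (verts (universal_cover G arev v0)) (H_uni v0)"
proof -
  have "\<exists>T. (T \<subseteq> verts G \<and> matching_poly T z = 0) \<and>
      (\<forall>T'. T' \<subseteq> verts G \<and> matching_poly T' z = 0 \<longrightarrow> card T \<le> card T')"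
    by (rule ex_has_least_nat[of _ S]) (use assms in simp)
  then obtain T where T: "T \<subseteq> verts G" "matching_poly T z = 0"
    and least: "\<And>T'. T' \<subseteq> verts G \<Longrightarrow> matching_poly T' z = 0 \<Longrightarrow> card T \<le> card T'"
    by blast
  have finT: "finite T" by (rule finite_subset[OF T(1)]) simp
  obtain u where u: "u \<in> T" using T(2) matching_poly_empty by fastforce
  then have u': "u \<in> verts G" using T by blast
  have "matching_poly (T - {u}) z \<noteq> 0"
    using least[of "T - {u}"] T(1) card_Diff1_less[OF finT u] by fastforce
  then have root: "path_tree_fun z T u [] \<noteq> 0"
    using u u' by (auto simp: path_tree_fun_def path_weight_def apath_Nil_iff)
  obtain q where "awalk v0 q u"
    using reachable_imp_walk[OF base u'] by blast
  then have "\<exists>f x. f \<in> finsupp (U v0) \<and> f x \<noteq> 0 \<and> (\<forall>x. f x \<noteq> 0 \<longrightarrow> H_uni v0 f x = z * f x)"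
    using path_tree_fun_finsupp root path_tree_eigenfunction[OF T]
    by (rule change_base_eigenfunction)
  then obtain f where "\<exists>x. f \<in> finsupp (U v0) \<and> f x \<noteq> 0 \<and> (\<forall>x. f x \<noteq> 0 \<longrightarrow> H_uni v0 f x = z * f x)"
    by (rule exE)
  then obtain x where f: "f \<in> finsupp (U v0) \<and> f x \<noteq> 0 \<and> (\<forall>x. f x \<noteq> 0 \<longrightarrow> H_uni v0 f x = z * f x)"
    by (rule exE)
  show ?thesis
  proof (rule universal_spectral_radius_ge)
    show "f \<in> finsupp (U v0)" by (rule conjunct1[OF f])
    show "f x \<noteq> 0" by (rule conjunct1[OF conjunct2[OF f]])
    show "H_uni v0 f x = z * f x" if "f x \<noteq> 0" for x
      using conjunct2[OF conjunct2[OF f]] that by (elim allE impE)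
  qed
qed

end

section \<open>Finitely supported solutions on the lattice\<close>

text \<open>
  A square matrix indexed by an arbitrary finite set, whose determinant is written as a Leibniz sum,
  is transported along an enumeration of the index set to a matrix in the sense of
  \<open>Jordan_Normal_Form\<close>.
\<close>

lemma leibniz_nonzero_imp_injective:
  fixes K :: "'v \<Rightarrow> 'v \<Rightarrow> complex"
  assumes A: "finite A"
    and nz: "(\<Sum>p | p permutes A. of_int (sign p) * (\<Prod>i\<in>A. K i (p i))) \<noteq> 0"
    and ker: "\<And>u. u \<in> A \<Longrightarrow> (\<Sum>v\<in>A. K u v * y v) = 0"
    and v: "v \<in> A"
  shows "y v = 0"
proof (rule ccontr)
  assume yv: "y v \<noteq> 0"
  define n where "n = card A"
  obtain b where b: "bij_betw b {0..<n} A"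
    using ex_bij_betw_nat_finite[OF A] by (auto simp: n_def)
  define M where "M = Matrix.mat n n (\<lambda>(i, j). K (b i) (b j))"
  define x where "x = Matrix.vec n (\<lambda>j. y (b j))"
  have M: "M \<in> carrier_mat n n" by (simp add: M_def)
  have b_in: "b i \<in> A" if "i < n" for i
    using b that by (auto simp: bij_betw_def)
  have "M *\<^sub>v x = 0\<^sub>v n"
  proof
    fix i assume "i < dim_vec (0\<^sub>v n)"
    then have i: "i < n" by simp
    have "vec_index (M *\<^sub>v x) i = (\<Sum>j\<in>{0..<n}. K (b i) (b j) * y (b j))"
      using i by (simp add: M_def x_def scalar_prod_def)
    also have "\<dots> = (\<Sum>v\<in>A. K (b i) v * y v)"
      by (rule sum.reindex_bij_betw[OF b])
    finally show "vec_index (M *\<^sub>v x) i = vec_index (0\<^sub>v n) i"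
      using ker b_in i by simp
  qed (simp add: M_def)
  moreover have "x \<noteq> 0\<^sub>v n"
  proof -
    obtain j where j: "j < n" "b j = v"
      using b v by (auto simp: bij_betw_def)
    then have "vec_index x j \<noteq> 0" using yv by (simp add: x_def)
    then show ?thesis using j(1) by auto
  qed
  ultimately have "Determinant.det M = 0"
    using det_0_iff_vec_prod_zero_field[OF M] by (metis carrier_vecI dim_vec x_def)
  have "(\<Sum>p | p permutes A. of_int (sign p) * (\<Prod>i\<in>A. K i (p i))) =
      (\<Sum>p | p permutes {0..<n}. of_int (sign p) * (\<Prod>i\<in>{0..<n}. K (b i) (b (p i))))"
  proof (rule sum.reindex_bij_witness[of _ "map_permutation {0..<n} b" "map_permutation A (inv_into {0..<n} b)"])
    let ?c = "inv_into {0..<n} b"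
    have c: "bij_betw ?c A {0..<n}" using b by (rule bij_betw_inv_into)
    fix p assume "p \<in> {p. p permutes A}"
    then have p: "p permutes A" by simp
    show q: "map_permutation A ?c p \<in> {p. p permutes {0..<n}}"
      using map_permutation_permutes[OF c p] by simp
    show "map_permutation {0..<n} b (map_permutation A ?c p) = p"
      using bij_betw_inv_into_right[OF b] by (rule map_permutation_compose_inv[OF c p])
    have "(\<Prod>i\<in>{0..<n}. K (b i) (b (map_permutation A ?c p i))) = (\<Prod>i\<in>{0..<n}. K (b i) (p (b i)))"
    proof (rule prod.cong)
      fix i assume i: "i \<in> {0..<n}"
      then have "b i \<in> A" "?c (b i) = i"
        using b_in bij_betw_inv_into_left[OF b] by auto
      then have "map_permutation A ?c p i = ?c (p (b i))" "p (b i) \<in> A"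
        using map_permutation_apply[of ?c A "b i" p] c permutes_in_image[OF p]
        by (auto simp: bij_betw_def)
      then show "K (b i) (b (map_permutation A ?c p i)) = K (b i) (p (b i))"
        using bij_betw_inv_into_right[OF b] by simp
    qed simp
    also have "\<dots> = (\<Prod>i\<in>A. K i (p i))"
      by (rule prod.reindex_bij_betw[OF b])
    finally show "of_int (sign (map_permutation A ?c p)) * (\<Prod>i\<in>{0..<n}. K (b i) (b (map_permutation A ?c p i))) =
        of_int (sign p) * (\<Prod>i\<in>A. K i (p i))"
      using sign_map_permutation[of ?c A p] c p A by (simp add: bij_betw_def)
  next
    fix p assume "p \<in> {p. p permutes {0..<n}}"
    then have p: "p permutes {0..<n}" by simp
    show "map_permutation {0..<n} b p \<in> {p. p permutes A}"
      using map_permutation_permutes[OF b p] by simp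
    show "map_permutation A (inv_into {0..<n} b) (map_permutation {0..<n} b p) = p"
      using bij_betw_inv_into_left[OF b] by (rule map_permutation_compose_inv[OF b p])
  qed
  also have "\<dots> = Determinant.det M"
    unfolding det_def'[OF M] by (intro sum.cong) (auto simp: M_def permutes_in_image intro!: prod.cong)
  finally show False using nz \<open>Determinant.det M = 0\<close> by simp
qed

text \<open>
  The coefficients are chosen one after the other; every \<open>x\<close> excludes at most one value of each.
\<close>

lemma generic_functional:
  fixes \<Delta> :: "('e \<Rightarrow> int) set"
  assumes "finite P" "finite \<Delta>" "\<And>x. x \<in> \<Delta> \<Longrightarrow> \<exists>y\<in>P. x y \<noteq> 0"
  shows "\<exists>c :: 'e \<Rightarrow> int. \<forall>x\<in>\<Delta>. (\<Sum>y\<in>P. c y * x y) \<noteq> 0"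
  using assms
proof (induction P arbitrary: \<Delta>)
  case empty
  then show ?case by auto
next
  case (insert a P)
  define \<Delta>' where "\<Delta>' = {x \<in> \<Delta>. \<exists>y\<in>P. x y \<noteq> 0}"
  have "\<exists>c :: 'e \<Rightarrow> int. \<forall>x\<in>\<Delta>'. (\<Sum>y\<in>P. c y * x y) \<noteq> 0"
    by (rule insert.IH) (use insert.prems in \<open>auto simp: \<Delta>'_def\<close>)
  then obtain c :: "'e \<Rightarrow> int" where c: "\<And>x. x \<in> \<Delta>' \<Longrightarrow> (\<Sum>y\<in>P. c y * x y) \<noteq> 0"
    by blast
  obtain m where m: "m \<notin> (\<lambda>x. - (\<Sum>y\<in>P. c y * x y) div x a) ` \<Delta>"
    using ex_new_if_finite[of "(\<lambda>x. - (\<Sum>y\<in>P. c y * x y) div x a) ` \<Delta>"] insert.prems(1)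
    by auto
  have eq: "(\<Sum>y\<in>insert a P. (c(a := m)) y * x y) = m * x a + (\<Sum>y\<in>P. c y * x y)" for x
    using insert.hyps by (auto intro!: sum.cong)
  have "(\<Sum>y\<in>insert a P. (c(a := m)) y * x y) \<noteq> 0" if x: "x \<in> \<Delta>" for x
  proof (cases "x a = 0")
    case True
    then have "x \<in> \<Delta>'" using insert.prems(2)[OF x] x by (auto simp: \<Delta>'_def)
    then show ?thesis unfolding eq using c True by simp
  next
    case False
    show ?thesis
    proof
      assume "(\<Sum>y\<in>insert a P. (c(a := m)) y * x y) = 0"
      then have "- (\<Sum>y\<in>P. c y * x y) = m * x a" unfolding eq by simp
      then have "m = - (\<Sum>y\<in>P. c y * x y) div x a" using False by simp
      then show False using m x by blast
    qed
  qed
  then show ?case by blast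
qed

context schroedinger_graph
begin

text \<open>
  Summing the system against a character \<open>ch\<close> of the lattice turns translation by \<open>arc_class e\<close> into
  multiplication by \<open>ch (arc_class e)\<close>.
\<close>

lemma lattice_solution_fourier:
  assumes sol: "lattice_solution z g" and v: "v \<in> verts G" and X: "finite X"
    and supp: "\<And>u x. u \<in> verts G \<Longrightarrow> g u x \<noteq> 0 \<Longrightarrow> x \<in> X"
    and ch: "\<And>x y. ch (x + y) = ch x * ch y"
  shows "(\<Sum>u\<in>verts G. char_entry z (\<lambda>e. ch (arc_class e)) v u * (\<Sum>x\<in>X. g u x * ch (- x))) = 0"
proof -
  define Y where "Y = X \<union> (\<Union>e\<in>arcs G. (\<lambda>x. x - arc_class e) ` X)"
  define h where "h u = (\<Sum>x\<in>X. g u x * ch (- x))" for u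
  have Y: "finite Y" "X \<subseteq> Y" using X by (auto simp: Y_def)
  have h_Y: "(\<Sum>x\<in>Y. g u x * ch (- x)) = h u" if "u \<in> verts G" for u
    unfolding h_def using Y supp[OF that] by (intro sum.mono_neutral_right) auto
  have shift: "(\<Sum>x\<in>Y. g (head G e) (x + arc_class e) * ch (- x)) = ch (arc_class e) * h (head G e)"
    if e: "e \<in> outs v" for e
  proof -
    let ?d = "arc_class e"
    have inj: "inj_on (\<lambda>x. x + ?d) Y" by (auto simp: inj_on_def)
    have "(\<Sum>x\<in>Y. g (head G e) (x + ?d) * ch (- x)) =
        (\<Sum>x\<in>Y. ch ?d * (g (head G e) (x + ?d) * ch (- (x + ?d))))"
    proof (rule sum.cong)
      fix x
      have "ch (- x) = ch (?d + - (x + ?d))" by simp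
      also have "\<dots> = ch ?d * ch (- (x + ?d))" by (rule ch)
      finally show "g (head G e) (x + ?d) * ch (- x) = ch ?d * (g (head G e) (x + ?d) * ch (- (x + ?d)))"
        by simp
    qed simp
    also have "\<dots> = ch ?d * (\<Sum>x\<in>(\<lambda>x. x + ?d) ` Y. g (head G e) x * ch (- x))"
      by (simp add: sum.reindex[OF inj] sum_distrib_left)
    also have "(\<Sum>x\<in>(\<lambda>x. x + ?d) ` Y. g (head G e) x * ch (- x)) = h (head G e)"
      unfolding h_def
    proof (rule sum.mono_neutral_right)
      show "X \<subseteq> (\<lambda>x. x + ?d) ` Y"
      proof
        fix x assume "x \<in> X"
        then have "x - ?d \<in> Y" using e by (auto simp: Y_def)
        then show "x \<in> (\<lambda>x. x + ?d) ` Y" by (rule rev_image_eqI) simp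
      qed
    qed (use Y supp[of "head G e"] e in auto)
    finally show ?thesis .
  qed
  have "z * h v = (\<Sum>x\<in>Y. z * g v x * ch (- x))"
    by (simp add: h_Y[OF v, symmetric] sum_distrib_left mult.assoc)
  also have "\<dots> = (\<Sum>x\<in>Y. ((\<Sum>e\<in>outs v. w e * g (head G e) (x + arc_class e)) + of_real (V v) * g v x) * ch (- x))"
    using sol v by (simp add: lattice_solution_def)
  also have "\<dots> = (\<Sum>e\<in>outs v. w e * (\<Sum>x\<in>Y. g (head G e) (x + arc_class e) * ch (- x))) + of_real (V v) * h v"
    unfolding distrib_right sum.distrib sum_distrib_right sum_distrib_left h_Y[OF v, symmetric]
    by (subst sum.swap) (simp add: mult.assoc)
  also have "\<dots> = (\<Sum>e\<in>outs v. ch (arc_class e) * w e * h (head G e)) + of_real (V v) * h v"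
    using shift by (simp add: mult.left_commute mult.assoc)
  also have "(\<Sum>e\<in>outs v. ch (arc_class e) * w e * h (head G e)) =
      (\<Sum>u\<in>verts G. \<Sum>e\<in>{e \<in> outs v. head G e = u}. ch (arc_class e) * w e * h (head G e))"
    by (rule sum.group[symmetric]) auto
  also have "\<dots> = (\<Sum>u\<in>verts G. (\<Sum>e\<in>arcs_between v u. ch (arc_class e) * w e) * h u)"
    unfolding sum_distrib_right by (intro sum.cong) (auto simp: arcs_between_def)
  finally have eq: "(\<Sum>u\<in>verts G. (\<Sum>e\<in>arcs_between v u. ch (arc_class e) * w e) * h u) = (z - of_real (V v)) * h v"
    by (simp add: algebra_simps)
  have "(\<Sum>u\<in>verts G. char_entry z (\<lambda>e. ch (arc_class e)) v u * h u) =
      (\<Sum>u\<in>verts G. if v = u then (z - of_real (V v)) * h v else 0) -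
      (\<Sum>u\<in>verts G. (\<Sum>e\<in>arcs_between v u. ch (arc_class e) * w e) * h u)"
    unfolding sum_subtractf[symmetric] by (intro sum.cong) (auto simp: char_entry_def left_diff_distrib)
  then show ?thesis using v eq unfolding h_def by simp
qed

definition no_finite_solutions :: "complex \<Rightarrow> bool" where
  "no_finite_solutions z \<longleftrightarrow> (\<forall>g X. lattice_solution z g \<longrightarrow> finite X \<longrightarrow>
    (\<forall>x\<in>X. \<forall>y. y \<notin> orientation \<longrightarrow> x y = 0) \<longrightarrow>
    (\<forall>u\<in>verts G. \<forall>x. g u x \<noteq> 0 \<longrightarrow> x \<in> X) \<longrightarrow> (\<forall>u\<in>verts G. \<forall>x. g u x = 0))"

text \<open>
  The characters \<open>x \<mapsto> \<sigma> x * t powi ht x\<close> deform the signing, which is the case \<open>t = 1\<close>, along a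
  direction \<open>ht\<close> that separates the points of the support.  The determinant stays nonzero for \<open>t\<close>
  near \<open>1\<close>, so the Fourier transform vanishes there.  It is a Laurent polynomial in \<open>t\<close> whose
  coefficients are, up to signs, the values of the solution.
\<close>

lemma signing_no_finite_solutions:
  assumes s: "s \<in> signings"
    and det: "(\<Sum>p | p permutes verts G. of_int (sign p) * (\<Prod>i\<in>verts G. char_entry z s i (p i))) \<noteq> 0"
  shows "no_finite_solutions z"
  unfolding no_finite_solutions_def
proof (intro allI impI ballI)
  fix g X u x0
  assume sol: "lattice_solution z g" and X1: "finite X"
    and X3': "\<forall>x\<in>X. \<forall>y. y \<notin> orientation \<longrightarrow> x y = 0"
    and X2': "\<forall>u\<in>verts G. \<forall>x. g u x \<noteq> 0 \<longrightarrow> x \<in> X"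
    and u: "u \<in> verts G"
  have X2: "x \<in> X" if "u \<in> verts G" "g u x \<noteq> 0" for u x
    using X2' that by blast
  have X3: "x y = 0" if "x \<in> X" "y \<notin> orientation" for x y
    using X3' that by blast
  note X = X1 X2 X3
  show "g u x0 = 0"
  proof (rule ccontr)
    assume nz: "g u x0 \<noteq> 0"
    then have x0: "x0 \<in> X" using X(2) u by blast
    have finP: "finite orientation"
      by (rule finite_subset[OF orientation_subset]) simp
    have "\<exists>c. \<forall>x\<in>(\<lambda>(x, y). x - y) ` {(x, y) \<in> X \<times> X. x \<noteq> y}. (\<Sum>y\<in>orientation. c y * x y) \<noteq> 0"
    proof (rule generic_functional[OF finP])
      show "finite ((\<lambda>(x, y). x - y) ` {(x, y) \<in> X \<times> X. x \<noteq> y})"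
        by (rule finite_imageI, rule finite_subset[of _ "X \<times> X"]) (use X(1) in auto)
    next
      fix d assume "d \<in> (\<lambda>(x, y). x - y) ` {(x, y) \<in> X \<times> X. x \<noteq> y}"
      then obtain x y where xy: "x \<in> X" "y \<in> X" "x \<noteq> y" "d = x - y" by auto
      then obtain e where "x e \<noteq> y e" by (auto simp: fun_eq_iff)
      then show "\<exists>e\<in>orientation. d e \<noteq> 0"
        using xy X(3)[of x e] X(3)[of y e] by (intro bexI[of _ e]) auto
    qed
    then obtain c where c: "\<And>x y. x \<in> X \<Longrightarrow> y \<in> X \<Longrightarrow> x \<noteq> y \<Longrightarrow> (\<Sum>e\<in>orientation. c e * (x - y) e) \<noteq> 0"
      by auto
    define ht where "ht x = (\<Sum>e\<in>orientation. c e * x e)" for x :: "'e \<Rightarrow> int"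
    have ht_add: "ht (x + y) = ht x + ht y" for x y
      by (simp add: ht_def algebra_simps sum.distrib)
    have ht_inj: "x = y" if "x \<in> X" "y \<in> X" "ht x = ht y" for x y
      using c[OF that(1,2)] that(3) by (auto simp: ht_def algebra_simps sum_subtractf)
    define \<sigma> where "\<sigma> x = (\<Prod>e\<in>orientation. s e powi x e)" for x :: "'e \<Rightarrow> int"
    have s_val: "s e = 1 \<or> s e = - 1" for e
      using s by (cases "e \<in> arcs G") (auto simp: signings_def)
    then have s_nz: "s e \<noteq> 0" for e by (metis one_neq_zero neg_equal_0_iff_equal)
    have \<sigma>_add: "\<sigma> (x + y) = \<sigma> x * \<sigma> y" for x y
      using s_nz by (simp add: \<sigma>_def power_int_add prod.distrib)
    have \<sigma>_nz: "\<sigma> x \<noteq> 0" for x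
      using s_nz finP by (simp add: \<sigma>_def)
    have \<sigma>_arc: "\<sigma> (arc_class e) = s e" if e: "e \<in> arcs G" for e
    proof -
      have "\<sigma> (arc_class e) = (\<Prod>y\<in>orientation. if y = e \<or> y = arev e then s e else 1)"
        unfolding \<sigma>_def
      proof (rule prod.cong)
        fix y assume "y \<in> orientation"
        moreover have "s (arev e) = s e" using s by (simp add: signings_def)
        moreover have "inverse (s e) = s e" using s_val[of e] by auto
        ultimately show "s y powi arc_class e y = (if y = e \<or> y = arev e then s e else 1)"
          using arev_neq[OF e] by (auto simp: arc_class_def)
      qed simp
      also have "\<dots> = (\<Prod>y\<in>orientation \<inter> {e, arev e}. s e)"
        using finP by (intro prod.mono_neutral_cong_right) auto
      also have "\<dots> = s e"
      proof (cases "e \<in> orientation")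
        case True
        then have "orientation \<inter> {e, arev e} = {e}" using orientation_iff[OF e] by auto
        then show ?thesis by simp
      next
        case False
        then have "orientation \<inter> {e, arev e} = {arev e}" using orientation_iff[OF e] by auto
        then show ?thesis by simp
      qed
      finally show ?thesis .
    qed
    define ch where "ch t x = \<sigma> x * t powi ht x" for t :: complex and x
    define D where "D t = (\<Sum>p | p permutes verts G. of_int (sign p) *
      (\<Prod>i\<in>verts G. char_entry z (\<lambda>e. ch t (arc_class e)) i (p i)))" for t
    have "D 1 \<noteq> 0"
    proof -
      have "char_entry z (\<lambda>e. ch 1 (arc_class e)) i j = char_entry z s i j" for i j
        unfolding char_entry_def by (auto simp: ch_def \<sigma>_arc arcs_between_def)
      then show ?thesis using det by (simp add: D_def)
    qed
    moreover have "isCont D 1"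
      unfolding D_def char_entry_def ch_def by (intro continuous_intros) auto
    ultimately have "\<forall>\<^sub>F t in nhds 1. D t \<noteq> 0"
      by (simp add: continuous_at tendsto_imp_eventually_ne isCont_def eventually_nhds_conv_at)
    moreover have "\<forall>\<^sub>F t in nhds 1. t \<noteq> (0 :: complex)"
      by (intro t1_space_nhds) simp
    ultimately have "\<forall>\<^sub>F t in nhds 1. D t \<noteq> 0 \<and> t \<noteq> 0" by (rule eventually_conj)
    then obtain S where S: "open S" "1 \<in> S" "\<And>t. t \<in> S \<Longrightarrow> D t \<noteq> 0 \<and> t \<noteq> 0"
      unfolding eventually_nhds by blast
    obtain r where r: "r > 0" "ball 1 r \<subseteq> S"
      using S(1,2) by (auto simp: open_contains_ball)
    have infS: "infinite S"
      using uncountable_ball[OF r(1), of 1] finite_subset[OF r(2)] countable_finite by auto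
    have vanish: "(\<Sum>x\<in>X. g u x * ch t (- x)) = 0" if t: "t \<in> S" for t
    proof (rule leibniz_nonzero_imp_injective[of "verts G"])
      show "(\<Sum>p | p permutes verts G. of_int (sign p) *
          (\<Prod>i\<in>verts G. char_entry z (\<lambda>e. ch t (arc_class e)) i (p i))) \<noteq> 0"
        using S(3)[OF t] by (simp add: D_def)
      have mult: "ch t (x + y) = ch t x * ch t y" for x y
        using S(3)[OF t] by (simp add: ch_def \<sigma>_add ht_add power_int_add)
      show "(\<Sum>u\<in>verts G. char_entry z (\<lambda>e. ch t (arc_class e)) v u * (\<Sum>x\<in>X. g u x * ch t (- x))) = 0"
        if "v \<in> verts G" for v
        by (rule lattice_solution_fourier[OF sol that X(1) X(2) mult])
    qed (use u in auto)
    define N where "N = Max (ht ` X)"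
    have N: "ht x \<le> N" if "x \<in> X" for x
      using X(1) that by (simp add: N_def)
    \<comment> \<open>Multiplication by \<open>t powi N\<close> clears the negative exponents.\<close>
    define q where "q = (\<Sum>x\<in>X. monom (g u x * \<sigma> (- x)) (nat (N - ht x)))"
    have "poly q t = 0" if t: "t \<in> S" for t
    proof -
      have t0: "t \<noteq> 0" using S(3)[OF t] by simp
      have "poly q t = (\<Sum>x\<in>X. g u x * \<sigma> (- x) * t powi (N - ht x))"
        unfolding q_def poly_sum poly_monom
        using N by (intro sum.cong) (auto simp: power_int_def)
      also have "\<dots> = t powi N * (\<Sum>x\<in>X. g u x * ch t (- x))"
      proof -
        have "ht (- x) = - ht x" for x by (simp add: ht_def sum_negf)
        then show ?thesis
          using t0 by (simp add: ch_def sum_distrib_left power_int_diff power_int_minus field_simps)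
      qed
      finally show ?thesis using vanish[OF t] by simp
    qed
    then have "S \<subseteq> {t. poly q t = 0}" by auto
    then have "infinite {t. poly q t = 0}" using infS by (metis finite_subset)
    then have "q = 0" using poly_roots_finite by auto
    then have "coeff q (nat (N - ht x0)) = 0" by simp
    moreover have "coeff q (nat (N - ht x0)) = (\<Sum>x\<in>X. if x = x0 then g u x * \<sigma> (- x) else 0)"
      unfolding q_def coeff_sum coeff_monom
    proof (rule sum.cong)
      fix x assume "x \<in> X"
      then show "(if nat (N - ht x) = nat (N - ht x0) then g u x * \<sigma> (- x) else 0) =
          (if x = x0 then g u x * \<sigma> (- x) else 0)"
        using ht_inj[OF _ x0] N N[OF x0] by (auto simp: eq_nat_nat_iff)
    qed simp
    ultimately show False using nz \<sigma>_nz x0 X(1) by simp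
  qed
qed

end

section \<open>Square summable solutions on the lattice\<close>

text \<open>
  If the functions in \<open>K\<close> are determined on \<open>B\<close> by their values on \<open>D\<close>, then the dimension of their
  restrictions to \<open>B\<close> is at most \<open>card D\<close>.  The induction adds one point \<open>d\<close> at a time: modulo a
  single function \<open>h\<close> with \<open>h d \<noteq> 0\<close>, every function in \<open>K\<close> vanishes at \<open>d\<close>.  One Gram-Schmidt step
  makes \<open>h\<close> orthogonal to the basis found before.
\<close>

lemma orthonormal_expansion:
  fixes K :: "('a \<Rightarrow> complex) set"
  assumes "finite D" "finite B"
    and "\<And>f g a b. f \<in> K \<Longrightarrow> g \<in> K \<Longrightarrow> (\<lambda>x. a * f x + b * g x) \<in> K"
    and "\<And>f x. f \<in> K \<Longrightarrow> (\<And>d. d \<in> D \<Longrightarrow> f d = 0) \<Longrightarrow> x \<in> B \<Longrightarrow> f x = 0"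
  shows "\<exists>U. finite U \<and> card U \<le> card D \<and>
    (\<forall>u\<in>U. \<forall>v\<in>U. (\<Sum>x\<in>B. u x * cnj (v x)) = of_bool (u = v)) \<and>
    (\<forall>f\<in>K. \<exists>c. \<forall>x\<in>B. f x = (\<Sum>u\<in>U. c u * u x))"
  using assms
proof (induction D arbitrary: K)
  case empty
  then show ?case by (intro exI[of _ "{}"]) auto
next
  case (insert d D)
  define ip where "ip f g = (\<Sum>x\<in>B. f x * cnj (g x))" for f g :: "'a \<Rightarrow> complex"
  define K' where "K' = {f \<in> K. f d = 0}"
  have "\<exists>U. finite U \<and> card U \<le> card D \<and>
    (\<forall>u\<in>U. \<forall>v\<in>U. (\<Sum>x\<in>B. u x * cnj (v x)) = of_bool (u = v)) \<and>
    (\<forall>f\<in>K'. \<exists>c. \<forall>x\<in>B. f x = (\<Sum>u\<in>U. c u * u x))"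
  proof (rule insert.IH)
    show "f x = 0" if "f \<in> K'" "\<And>d. d \<in> D \<Longrightarrow> f d = 0" "x \<in> B" for f x
    proof (rule insert.prems(3))
      show "f e = 0" if "e \<in> insert d D" for e
        using that \<open>f \<in> K'\<close> \<open>\<And>d. d \<in> D \<Longrightarrow> f d = 0\<close> by (auto simp: K'_def)
    qed (use that in \<open>auto simp: K'_def\<close>)
  qed (use insert.prems(1,2) in \<open>auto simp: K'_def\<close>)
  then obtain U where U: "finite U" "card U \<le> card D"
    and ortho: "\<And>u v. u \<in> U \<Longrightarrow> v \<in> U \<Longrightarrow> ip u v = of_bool (u = v)"
    and span: "\<And>f. f \<in> K' \<Longrightarrow> \<exists>c. \<forall>x\<in>B. f x = (\<Sum>u\<in>U. c u * u x)"
    unfolding ip_def by blast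
  show ?case
  proof (cases "K' = K")
    case True
    then show ?thesis
      using U ortho span insert.hyps by (intro exI[of _ U]) (auto simp: ip_def)
  next
    case False
    then obtain h where h: "h \<in> K" "h d \<noteq> 0" by (auto simp: K'_def)
    define y where "y x = h x - (\<Sum>u\<in>U. ip h u * u x)" for x
    have y_ortho: "ip y v = 0" if "v \<in> U" for v
    proof -
      have "ip y v = ip h v - (\<Sum>x\<in>B. \<Sum>u\<in>U. ip h u * (u x * cnj (v x)))"
        by (simp add: ip_def[of y] ip_def[of h v] y_def left_diff_distrib sum_subtractf sum_distrib_right mult.assoc)
      also have "(\<Sum>x\<in>B. \<Sum>u\<in>U. ip h u * (u x * cnj (v x))) = (\<Sum>u\<in>U. ip h u * ip u v)"
        by (subst sum.swap) (simp add: ip_def sum_distrib_left)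
      also have "\<dots> = (\<Sum>u\<in>U. if u = v then ip h u else 0)"
        using that by (intro sum.cong) (auto simp: ortho)
      finally show ?thesis using U that by simp
    qed
    have decomp: "\<exists>c a. \<forall>x\<in>B. f x = (\<Sum>u\<in>U. c u * u x) + a * y x" if f: "f \<in> K" for f
    proof -
      let ?r = "f d / h d"
      have "(\<lambda>x. 1 * f x + (- ?r) * h x) \<in> K'"
        unfolding K'_def mem_Collect_eq using h(2) by (intro conjI insert.prems(2)[OF f h(1)]) simp
      then obtain c where c: "\<And>x. x \<in> B \<Longrightarrow> 1 * f x + (- ?r) * h x = (\<Sum>u\<in>U. c u * u x)"
        using span by blast
      have "f x = (\<Sum>u\<in>U. (c u + ?r * ip h u) * u x) + ?r * y x" if "x \<in> B" for x
      proof -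
        have "f x = (\<Sum>u\<in>U. c u * u x) + ?r * h x" using c[OF that] by (simp add: algebra_simps)
        then show ?thesis
          by (simp add: y_def distrib_right sum.distrib sum_distrib_left right_diff_distrib mult.assoc)
      qed
      then show ?thesis
        by (intro exI[of _ "\<lambda>u. c u + ?r * ip h u"] exI[of _ ?r] ballI)
    qed
    show ?thesis
    proof (cases "\<forall>x\<in>B. y x = 0")
      case True
      have "\<exists>c. \<forall>x\<in>B. f x = (\<Sum>u\<in>U. c u * u x)" if "f \<in> K" for f
        using decomp[OF that] True by auto
      then show ?thesis
        using U ortho insert.hyps by (intro exI[of _ U]) (auto simp: ip_def)
    next
      case False
      define n where "n = (\<Sum>x\<in>B. (cmod (y x))\<^sup>2)"
      have n: "n > 0"
        using False \<open>finite B\<close> unfolding n_def by (auto intro: sum_pos2)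
      have ip_y: "ip y y = of_real n"
        by (simp only: ip_def n_def of_real_sum complex_norm_square)
      define e where "e x = y x / of_real (sqrt n)" for x
      have sq: "complex_of_real (sqrt n) * of_real (sqrt n) = of_real n"
        using n by (simp flip: of_real_mult)
      have e_e: "ip e e = 1"
      proof -
        have "ip e e = ip y y / (of_real (sqrt n) * of_real (sqrt n))"
          by (simp add: ip_def e_def sum_divide_distrib)
        then show ?thesis using n by (simp only: sq ip_y) simp
      qed
      have e_u: "ip e u = 0" if "u \<in> U" for u
        using y_ortho[OF that] by (simp add: ip_def e_def sum_divide_distrib[symmetric])
      have u_e: "ip u e = 0" if "u \<in> U" for u
      proof -
        have "ip u e = cnj (ip e u)" by (simp add: ip_def mult.commute)
        then show ?thesis using e_u[OF that] by simp
      qed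
      have e_notin: "e \<notin> U" using e_e e_u by fastforce
      have "\<exists>c. \<forall>x\<in>B. f x = (\<Sum>u\<in>insert e U. c u * u x)" if f: "f \<in> K" for f
      proof -
        obtain c a where ca: "\<And>x. x \<in> B \<Longrightarrow> f x = (\<Sum>u\<in>U. c u * u x) + a * y x"
          using decomp[OF f] by blast
        have "(\<Sum>u\<in>insert e U. (c(e := a * of_real (sqrt n))) u * u x) = (\<Sum>u\<in>U. c u * u x) + a * y x" for x
        proof -
          have "(\<Sum>u\<in>U. (c(e := a * of_real (sqrt n))) u * u x) = (\<Sum>u\<in>U. c u * u x)"
            using e_notin by (intro sum.cong) auto
          then show ?thesis using U e_notin n by (simp add: e_def)
        qed
        then show ?thesis using ca by (intro exI[of _ "c(e := a * of_real (sqrt n))"]) simp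
      qed
      moreover have "card (insert e U) \<le> card (insert d D)"
        using U e_notin insert.hyps by simp
      moreover have "\<forall>u\<in>insert e U. \<forall>v\<in>insert e U. ip u v = of_bool (u = v)"
        using e_e e_u u_e ortho e_notin by auto
      ultimately show ?thesis
        using U by (intro exI[of _ "insert e U"]) (auto simp: ip_def)
    qed
  qed
qed

text \<open>
  The function \<open>k\<close> is the diagonal of the reproducing kernel of \<open>K\<close> on \<open>B\<close>; its sum over \<open>B\<close> is the
  trace of a projection, hence a dimension.
\<close>

lemma evaluation_bound:
  fixes K :: "('a \<Rightarrow> complex) set"
  assumes D: "finite D" and B: "finite B"
    and lin: "\<And>f g a b. f \<in> K \<Longrightarrow> g \<in> K \<Longrightarrow> (\<lambda>x. a * f x + b * g x) \<in> K"
    and det: "\<And>f x. f \<in> K \<Longrightarrow> (\<And>d. d \<in> D \<Longrightarrow> f d = 0) \<Longrightarrow> x \<in> B \<Longrightarrow> f x = 0"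
  shows "\<exists>k :: 'a \<Rightarrow> real. (\<forall>x. 0 \<le> k x) \<and> (\<Sum>x\<in>B. k x) \<le> card D \<and>
    (\<forall>f\<in>K. \<forall>x\<in>B. (cmod (f x))\<^sup>2 \<le> k x * (\<Sum>y\<in>B. (cmod (f y))\<^sup>2))"
proof -
  have "\<exists>U. finite U \<and> card U \<le> card D \<and>
    (\<forall>u\<in>U. \<forall>v\<in>U. (\<Sum>x\<in>B. u x * cnj (v x)) = of_bool (u = v)) \<and>
    (\<forall>f\<in>K. \<exists>c. \<forall>x\<in>B. f x = (\<Sum>u\<in>U. c u * u x))"
    using D B lin det by (rule orthonormal_expansion)
  then obtain U where U: "finite U" "card U \<le> card D"
    and ortho: "\<And>u v. u \<in> U \<Longrightarrow> v \<in> U \<Longrightarrow> (\<Sum>x\<in>B. u x * cnj (v x)) = of_bool (u = v)"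
    and span: "\<And>f. f \<in> K \<Longrightarrow> \<exists>c. \<forall>x\<in>B. f x = (\<Sum>u\<in>U. c u * u x)"
    by blast
  define k where "k x = (\<Sum>u\<in>U. (cmod (u x))\<^sup>2)" for x
  have unit: "(\<Sum>x\<in>B. (cmod (u x))\<^sup>2) = 1" if "u \<in> U" for u
  proof -
    have "complex_of_real (\<Sum>x\<in>B. (cmod (u x))\<^sup>2) = of_real 1"
      using ortho[OF that that] by (simp only: of_real_sum complex_norm_square) simp
    then show ?thesis by (simp only: of_real_eq_iff)
  qed
  have "(\<Sum>x\<in>B. k x) = (\<Sum>u\<in>U. \<Sum>x\<in>B. (cmod (u x))\<^sup>2)"
    unfolding k_def by (rule sum.swap)
  also have "\<dots> = card U" using unit by simp
  finally have trace: "(\<Sum>x\<in>B. k x) \<le> card D" using U by simp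
  have "(cmod (f x))\<^sup>2 \<le> k x * (\<Sum>y\<in>B. (cmod (f y))\<^sup>2)" if f: "f \<in> K" and x: "x \<in> B" for f x
  proof -
    obtain c where c: "\<And>x. x \<in> B \<Longrightarrow> f x = (\<Sum>u\<in>U. c u * u x)" using span[OF f] by blast
    have "complex_of_real (\<Sum>y\<in>B. (cmod (f y))\<^sup>2) = (\<Sum>y\<in>B. (\<Sum>u\<in>U. c u * u y) * cnj (\<Sum>v\<in>U. c v * v y))"
      unfolding of_real_sum complex_norm_square by (rule sum.cong) (simp_all only: c)
    also have "\<dots> = (\<Sum>y\<in>B. \<Sum>u\<in>U. \<Sum>v\<in>U. c u * cnj (c v) * (u y * cnj (v y)))"
      by (simp add: sum_product mult.assoc mult.left_commute)
    also have "\<dots> = (\<Sum>u\<in>U. \<Sum>v\<in>U. \<Sum>y\<in>B. c u * cnj (c v) * (u y * cnj (v y)))"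
      by (subst sum.swap) (intro sum.cong sum.swap refl)
    also have "\<dots> = (\<Sum>u\<in>U. \<Sum>v\<in>U. c u * cnj (c v) * of_bool (u = v))"
      by (intro sum.cong refl) (simp add: sum_distrib_left[symmetric] ortho)
    also have "\<dots> = (\<Sum>u\<in>U. c u * cnj (c u))"
      using U by (intro sum.cong) (auto simp: of_bool_def if_distrib cong: if_cong)
    also have "\<dots> = of_real (\<Sum>u\<in>U. (cmod (c u))\<^sup>2)"
      by (simp only: of_real_sum complex_norm_square)
    finally have parseval: "(\<Sum>y\<in>B. (cmod (f y))\<^sup>2) = (\<Sum>u\<in>U. (cmod (c u))\<^sup>2)"
      by (simp only: of_real_eq_iff)
    have "cmod (f x) \<le> (\<Sum>u\<in>U. cmod (c u) * cmod (u x))"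
      unfolding c[OF x] by (rule sum_norm_le) (simp add: norm_mult)
    then have "(cmod (f x))\<^sup>2 \<le> (\<Sum>u\<in>U. cmod (c u) * cmod (u x))\<^sup>2"
      by (rule power_mono) simp
    also have "\<dots> \<le> (\<Sum>u\<in>U. (cmod (c u))\<^sup>2) * (\<Sum>u\<in>U. (cmod (u x))\<^sup>2)"
      by (rule Cauchy_Schwarz_ineq_sum)
    finally show ?thesis by (simp add: parseval k_def mult.commute)
  qed
  moreover have "0 \<le> k x" for x by (simp add: k_def sum_nonneg)
  ultimately show ?thesis using trace by blast
qed

definition lattice_box :: "'e set \<Rightarrow> int \<Rightarrow> int \<Rightarrow> ('e \<Rightarrow> int) set" where
  "lattice_box P a b = {x. (\<forall>y\<in>P. a \<le> x y \<and> x y < b) \<and> (\<forall>y. y \<notin> P \<longrightarrow> x y = 0)}"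

lemma lattice_box_finite_card:
  assumes P: "finite P" and ab: "a \<le> b"
  shows "finite (lattice_box P a b)" "card (lattice_box P a b) = nat (b - a) ^ card P"
proof -
  have "bij_betw (\<lambda>x. restrict x P) (lattice_box P a b) (PiE P (\<lambda>_. {a..<b}))"
  proof (rule bij_betw_byWitness[where f' = "\<lambda>x y. if y \<in> P then x y else 0"])
  qed (auto simp: lattice_box_def fun_eq_iff PiE_def extensional_def)
  moreover have "finite (PiE P (\<lambda>_. {a..<b}))" "card (PiE P (\<lambda>_. {a..<b})) = nat (b - a) ^ card P"
    using P by (simp_all add: finite_PiE card_PiE)
  ultimately show "finite (lattice_box P a b)" "card (lattice_box P a b) = nat (b - a) ^ card P"
    by (simp_all add: bij_betw_finite bij_betw_same_card)
qed

context schroedinger_graph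
begin

text \<open>
  The box with its \<open>k\<close> outermost layers removed.
\<close>

abbreviation Box :: "nat \<Rightarrow> nat \<Rightarrow> ('e \<Rightarrow> int) set" where
  "Box k n \<equiv> lattice_box orientation (int k) (int n - int k)"

lemma arc_class_range: "\<bar>arc_class e y\<bar> \<le> 1" "y \<notin> orientation \<Longrightarrow> arc_class e y = 0"
  by (auto simp: arc_class_def)

lemma Box_step:
  assumes "x \<in> Box (Suc k) n"
  shows "x + arc_class e \<in> Box k n"
proof -
  have "int k \<le> x y + arc_class e y \<and> x y + arc_class e y < int n - int k" if "y \<in> orientation" for y
    using assms that arc_class_range(1)[of e y] by (force simp: lattice_box_def)
  then show ?thesis
    using assms arc_class_range(2)[of _ e] by (simp add: lattice_box_def)
qed

lemma Box_step_back:
  assumes "x + arc_class e \<in> Box (Suc k) n"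
  shows "x \<in> Box k n"
  using Box_step[OF assms, of "arev e"] by (simp add: add.assoc)

lemma Box_mono: "Box (Suc k) n \<subseteq> Box k n"
  by (auto simp: lattice_box_def)

text \<open>
  A solution that vanishes on the two outermost layers of the box remains a solution after it is cut
  off outside the box.  The second layer matters at the points of the outermost one: their equations
  involve neighbours outside the box, where the cut changes the function, and neighbours in the
  second layer.
\<close>

lemma lattice_solution_determined:
  assumes none: "no_finite_solutions z"
    and sol: "lattice_solution z g" and n: "4 \<le> n"
    and zero: "\<And>v x. v \<in> verts G \<Longrightarrow> x \<in> Box 0 n - Box 2 n \<Longrightarrow> g v x = 0"
    and v: "v \<in> verts G" and x: "x \<in> Box 0 n"
  shows "g v x = 0"
proof -
  define h where "h v x = (if x \<in> Box 0 n then g v x else 0)" for v x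
  have h_inner: "h v x = 0" if "v \<in> verts G" "x \<notin> Box 2 n" for v x
    using zero[of v x] that by (auto simp: h_def)
  have "lattice_solution z h"
    unfolding lattice_solution_def
  proof (intro ballI allI)
    fix v x assume v: "v \<in> verts G"
    show "(\<Sum>e\<in>outs v. w e * h (head G e) (x + arc_class e)) + of_real (V v) * h v x = z * h v x"
    proof (cases "x \<in> Box 1 n")
      case True
      then have "x + arc_class e \<in> Box 0 n" for e
        using Box_step[of x 0 n e] by simp
      moreover have "x \<in> Box 0 n" using True Box_mono[of 0 n] by auto
      ultimately show ?thesis
        using sol v by (simp add: h_def lattice_solution_def)
    next
      case False
      then have "x \<notin> Box 2 n" using Box_mono[of 1 n] by (auto simp: numeral_2_eq_2)
      moreover have "x + arc_class e \<notin> Box 2 n" for e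
        using False Box_step_back[of x e 1 n] by (auto simp: numeral_2_eq_2)
      ultimately show ?thesis using h_inner v by simp
    qed
  qed
  moreover have "finite (Box 0 n)"
    using finite_subset[OF orientation_subset finite_arcs] by (rule lattice_box_finite_card) simp
  moreover have "\<forall>x\<in>Box 0 n. \<forall>y. y \<notin> orientation \<longrightarrow> x y = 0"
    by (simp add: lattice_box_def)
  moreover have "\<forall>u\<in>verts G. \<forall>x. h u x \<noteq> 0 \<longrightarrow> x \<in> Box 0 n"
    by (simp add: h_def)
  ultimately have "\<forall>u\<in>verts G. \<forall>x. h u x = 0"
    by (rule none[unfolded no_finite_solutions_def, THEN spec, THEN spec,
          THEN mp, THEN mp, THEN mp, THEN mp])
  then have "h v x = 0" using v by blast
  then show ?thesis using x by (simp add: h_def)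
qed

lemma lattice_solution_translate:
  assumes "lattice_solution z g" shows "lattice_solution z (\<lambda>v x. g v (x + a))"
proof -
  have "x + arc_class e + a = x + a + arc_class e" for x e by (simp add: ac_simps)
  then show ?thesis using assms unfolding lattice_solution_def by (simp only:) simp
qed

text \<open>
  For each point \<open>x\<close> of the box, the translate that moves \<open>a\<close> to \<open>x\<close> shows that \<open>C * k (v, x)\<close> is at
  least \<open>|g v a|\<^sup>2\<close>, where \<open>k\<close> is the kernel diagonal of \<open>evaluation_bound\<close>.  Summation over the \<open>n\<^sup>d\<close> points of the box bounds this by
  the size of the boundary layers, which is \<open>o(n\<^sup>d)\<close>.
\<close>

lemma no_ell2_lattice_solution:
  assumes none: "no_finite_solutions z"
    and sol: "lattice_solution z g"
    and bound: "\<And>Y. finite Y \<Longrightarrow> (\<Sum>(v, x)\<in>Y. (cmod (g v x))\<^sup>2) \<le> C"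
    and v: "v \<in> verts G"
  shows "g v a = 0"
proof -
  define d where "d = card orientation"
  define m where "m = card (verts G)"
  have finP: "finite orientation" by (rule finite_subset[OF orientation_subset]) simp
  have C: "0 \<le> C" using bound[of "{}"] by simp
  have main: "(cmod (g v a))\<^sup>2 * real n ^ d \<le> m * C * (real n ^ d - (real n - 4) ^ d)" if n: "4 \<le> n" for n
  proof -
    define B where "B = verts G \<times> Box 0 n"
    define D where "D = verts G \<times> (Box 0 n - Box 2 n)"
    define K where "K = {f. lattice_solution z (\<lambda>v x. f (v, x))}"
    have box: "finite (Box k n) \<and> card (Box k n) = (n - 2 * k) ^ d" if "2 * k \<le> n" for k
    proof -
      have "int k \<le> int n - int k" "nat (int n - int k - int k) = n - 2 * k"
        using that by simp_all
      then show ?thesis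
        using lattice_box_finite_card[OF finP, of "int k" "int n - int k"] by (simp add: d_def)
    qed
    have fin: "finite (Box 0 n)" "finite (Box 2 n)"
      and card: "card (Box 0 n) = n ^ d" "card (Box 2 n) = (n - 4) ^ d"
      using box[of 0] box[of 2] n by simp_all
    have sub: "Box 2 n \<subseteq> Box 0 n"
      using Box_mono[of 0 n] Box_mono[of 1 n] by (auto simp: numeral_2_eq_2)
    have card_D: "real (card D) = m * (real n ^ d - (real n - 4) ^ d)"
    proof -
      have "card D = m * (n ^ d - (n - 4) ^ d)"
        using fin sub card by (simp add: D_def m_def card_cartesian_product card_Diff_subset)
      moreover have "(n - 4) ^ d \<le> n ^ d" by (intro power_mono) auto
      ultimately show ?thesis using n by (simp add: of_nat_diff)
    qed
    have "\<exists>k :: _ \<Rightarrow> real. (\<forall>x. 0 \<le> k x) \<and> (\<Sum>x\<in>B. k x) \<le> card D \<and>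
        (\<forall>f\<in>K. \<forall>x\<in>B. (cmod (f x))\<^sup>2 \<le> k x * (\<Sum>y\<in>B. (cmod (f y))\<^sup>2))"
    proof (rule evaluation_bound)
      show "(\<lambda>x. r * f x + s * f' x) \<in> K" if "f \<in> K" "f' \<in> K" for f f' r s
      proof -
        define L where "L h v x = (\<Sum>e\<in>outs v. w e * h (head G e, x + arc_class e)) + of_real (V v) * h (v, x)"
          for h v x
        have K_iff: "h \<in> K \<longleftrightarrow> (\<forall>v\<in>verts G. \<forall>x. L h v x = z * h (v, x))" for h
          by (simp add: K_def lattice_solution_def L_def)
        have "L (\<lambda>x. r * f x + s * f' x) v x = r * L f v x + s * L f' v x" for v x
          by (simp add: L_def algebra_simps sum.distrib sum_distrib_left)
        then show ?thesis
          using that by (simp add: K_iff distrib_left mult.left_commute)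
      qed
    next
      fix f b assume f: "f \<in> K" and zero: "\<And>d. d \<in> D \<Longrightarrow> f d = 0" and b: "b \<in> B"
      obtain u x where ux: "b = (u, x)" "u \<in> verts G" "x \<in> Box 0 n" using b by (auto simp: B_def)
      have "(\<lambda>v x. f (v, x)) u x = 0"
      proof (rule lattice_solution_determined[OF none _ n])
        show "lattice_solution z (\<lambda>v x. f (v, x))" using f by (simp add: K_def)
        show "f (v, x) = 0" if "v \<in> verts G" "x \<in> Box 0 n - Box 2 n" for v x
          using that by (intro zero) (simp add: D_def)
      qed (use ux in simp_all)
      then show "f b = 0" using ux by simp
    qed (use fin in \<open>auto simp: B_def D_def\<close>)
    then obtain k :: "'v \<times> ('e \<Rightarrow> int) \<Rightarrow> real" where k: "\<And>x. 0 \<le> k x" "(\<Sum>x\<in>B. k x) \<le> card D"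
      and eval: "\<And>f x. f \<in> K \<Longrightarrow> x \<in> B \<Longrightarrow> (cmod (f x))\<^sup>2 \<le> k x * (\<Sum>y\<in>B. (cmod (f y))\<^sup>2)"
      by blast
    have pt: "(cmod (g v a))\<^sup>2 \<le> C * k (v, x)" if x: "x \<in> Box 0 n" for x
    proof -
      define f where "f = (\<lambda>(u, y). g u (y + (a - x)))"
      have "f \<in> K" using lattice_solution_translate[OF sol] by (simp add: K_def f_def)
      moreover have "(v, x) \<in> B" using v x by (simp add: B_def)
      ultimately have "(cmod (f (v, x)))\<^sup>2 \<le> k (v, x) * (\<Sum>y\<in>B. (cmod (f y))\<^sup>2)" by (rule eval)
      also have "(\<Sum>y\<in>B. (cmod (f y))\<^sup>2) = (\<Sum>(u, y)\<in>(\<lambda>(u, y). (u, y + (a - x))) ` B. (cmod (g u y))\<^sup>2)"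
        by (subst sum.reindex) (auto simp: inj_on_def f_def intro!: sum.cong)
      also have "k (v, x) * \<dots> \<le> k (v, x) * C"
        using fin k(1) by (intro mult_left_mono bound) (auto simp: B_def)
      finally show ?thesis by (simp add: f_def mult.commute)
    qed
    have "(cmod (g v a))\<^sup>2 * real n ^ d = (\<Sum>x\<in>Box 0 n. (cmod (g v a))\<^sup>2)"
      by (simp only: sum_constant card(1) of_nat_power mult.commute)
    also have "\<dots> \<le> (\<Sum>x\<in>Box 0 n. C * k (v, x))" using pt by (rule sum_mono)
    also have "\<dots> = C * (\<Sum>b\<in>Pair v ` Box 0 n. k b)"
      by (simp add: sum.reindex inj_on_def sum_distrib_left)
    also have "\<dots> \<le> C * (\<Sum>b\<in>B. k b)"
      using C k(1) fin v by (intro mult_left_mono sum_mono2) (auto simp: B_def)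
    also have "\<dots> \<le> C * card D" using k(2) C by (rule mult_left_mono)
    finally show ?thesis by (simp add: card_D mult_ac)
  qed
  have "(\<lambda>n. m * C * (1 - (1 - 4 / real n) ^ d)) \<longlonglongrightarrow> m * C * (1 - (1 - 0) ^ d)"
    by (intro tendsto_intros lim_const_over_n)
  moreover have "(cmod (g v a))\<^sup>2 \<le> m * C * (1 - (1 - 4 / real n) ^ d)" if "n \<ge> 4" for n
  proof -
    have n: "real n > 0" using that by simp
    have "(1 - 4 / real n) ^ d * real n ^ d = (real n - 4) ^ d"
      using n by (simp add: power_mult_distrib[symmetric] left_diff_distrib)
    then have eq: "m * C * (1 - (1 - 4 / real n) ^ d) * real n ^ d = m * C * (real n ^ d - (real n - 4) ^ d)"
      by (simp add: algebra_simps)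
    have "(cmod (g v a))\<^sup>2 * real n ^ d \<le> m * C * (1 - (1 - 4 / real n) ^ d) * real n ^ d"
      unfolding eq by (rule main[OF that])
    then show ?thesis using n by simp
  qed
  then have "eventually (\<lambda>n. (cmod (g v a))\<^sup>2 \<le> m * C * (1 - (1 - 4 / real n) ^ d)) sequentially"
    unfolding eventually_sequentially by blast
  ultimately have "(cmod (g v a))\<^sup>2 \<le> m * C * (1 - (1 - 0) ^ d)"
    by (rule tendsto_lowerbound) simp
  then show ?thesis by simp
qed

end

section \<open>Eigenvalues of the maximal abelian cover\<close>

theorem corollary3p11:
  fixes G :: "('v, 'e) pre_digraph" and arev :: "'e \<Rightarrow> 'e" and v0 :: 'v
    and w :: "'e \<Rightarrow> complex" and V :: "'v \<Rightarrow> real" and lam :: complex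
  assumes "bidirected_digraph G arev" and "fin_digraph G" and "connected G"
    and "v0 \<in> verts G"
    and "schroedinger_weights G arev w"
    and "eigenvalue_ell2 (verts (abelian_cover G arev v0)) (abelian_op G arev v0 w V) lam"
  shows "ereal (cmod lam) \<le>
    spectral_radius_ell2 (verts (universal_cover G arev v0)) (universal_op G arev v0 w V)"
proof -
  interpret schroedinger_graph G arev v0 w V
    using assms
    by (simp add: schroedinger_graph_def based_graph_def based_graph_axioms_def schroedinger_graph_axioms_def)
  show ?thesis
  proof (cases "matching_poly (verts G) lam = 0")
    case True
    then show ?thesis by (rule matching_poly_root_bound[OF order_refl])
  next
    case False
    then obtain s where s: "s \<in> signings"
      "(\<Sum>p | p permutes verts G. of_int (sign p) * (\<Prod>i\<in>verts G. char_entry lam s i (p i))) \<noteq> 0"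
      unfolding matching_poly_signings by (meson sum.neutral)
    obtain g v x C where g: "lattice_solution lam g" "v \<in> verts G" "g v x \<noteq> 0"
      and C: "\<And>Y. finite Y \<Longrightarrow> (\<Sum>(v, x)\<in>Y. (cmod (g v x))\<^sup>2) \<le> C"
      using abelian_eigenfunction_lattice_solution[OF assms(6)] by metis
    have "g v x = 0"
      by (rule no_ell2_lattice_solution[OF signing_no_finite_solutions[OF s] g(1) C g(2)])
    then show ?thesis using g(3) by simp
  qed
qed

end
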